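(* Let $\tau\in\mathbb{C}$ with $\operatorname{Im}\tau>0$, let $X_\tau=\mathbb{C}/(\mathbb{Z}+\tau\mathbb{Z})$, and let $X_{\tau,u}=X_\tau\setminus\{u\}$ be the once-punctured complex torus obtained by removing a point $u\in X_\tau$. Let $K_{\tau,u}$ and $c_{\tau,u}$ be the Bergman kernel and the fundamental metric of $X_{\tau,u}$, respectively, and in the local coordinate $w$ induced from $\mathbb{C}$ write $K_{\tau,u}=k_{\tau,u}(w)|dw|^2$ and $c_{\tau,u}=c_{\tau,u}(w)|dw|^2$. Then, as $w\to u$, $$\frac{\pi k_{\tau,u}(w)}{c_{\tau,u}^2(w)}\sim\frac{\pi\,|w-u|^2}{2\operatorname{Im}\tau}\to 0^+ .$$
   Context: Here $f\sim g$ as $w\to u$ means $f(w)/g(w)\to 1$, and $\to 0^+$ means tending to $0$ through positive values. Points of $X_\tau$ are written in the coordinate induced from $\mathbb{C}$, i.e. $z,w,u$ also denote complex numbers representing them (and $w\to u$ is taken with representatives satisfying $w\to u$ in $\mathbb{C}$). Bergman kernel: $K_{\tau,u}=\sum_j\varphi_j\otimes\overline{\varphi_j}$ for an orthonormal basis $(\varphi_j)$ of the space of holomorphic $1$-forms $\varphi$ on $X_{\tau,u}$ with finite norm $\|\varphi\|^2=i\int_{X_{\tau,u}}\varphi\wedge\overline{\varphi}$; if $\varphi_j=f_j(w)\,dw$ then $k_{\tau,u}(w)=\sum_j|f_j(w)|^2$. Evans-Selberg potential: on an open Riemann surface $\Sigma$, an Evans-Selberg potential with pole $q\in\Sigma$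 is a real-valued function $E_q(p)$ such that (i) $E_q$ is harmonic on $\Sigma\setminus\{q\}$; (ii) $E_q(p)\to+\infty$ as $p$ tends to the Alexandroff ideal boundary point $a_\infty$; (iii) $E_q(p)-\log|\varphi(p)-\varphi(q)|$ is bounded near $q$, with $\varphi$ a local coordinate. Fundamental metric: in the local coordinate $z=\varphi(p)$ it is $c(z)|dz|^2:=\exp\lim_{q\to p}\big(E_q(p)-\log|\varphi(p)-\varphi(q)|\big)|dz|^2$. On $X_{\tau,u}$ the potential with pole $w$ used to form the fundamental metric is $$E^{\tau,u}_w(z)=\log\left|\frac{\theta_1(z-w;q)}{\theta_1(z-u;q)}\right|,$$ where $q=\exp(\pi i\tau)$, $q^{1/4}=\exp(\pi i\tau/4)$ and $\theta_1(z;q)=2q^{1/4}\sin(\pi z)\prod_{n=1}^\infty(1-q^{2n})(1-2\cos(2\pi z)q^{2n}+q^{4n})$; thus $c_{\tau,u}(w)=\exp\lim_{z\to w}\big(E^{\tau,u}_w(z)-\log|z-w|\big)$. *)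

theory Defs
  imports "HOL-Complex_Analysis.Complex_Analysis" "HOL-Library.Landau_Symbols"
begin

definition torus_lattice :: "complex \<Rightarrow> complex set" where
  "torus_lattice \<tau> = {of_int m + of_int n * \<tau> | m n. True}"

text \<open>The representatives in \<open>\<complex>\<close> of the point \<open>u\<close> of the torus.\<close>

definition puncture_reps :: "complex \<Rightarrow> complex \<Rightarrow> complex set" where
  "puncture_reps \<tau> u = {u + l | l. l \<in> torus_lattice \<tau>}"

text \<open>A set containing exactly one representative of every point of the punctured torus.\<close>

definition fundamental_cell :: "complex \<Rightarrow> complex \<Rightarrow> complex set" where
  "fundamental_cell \<tau> u =
     {of_real s + of_real t * \<tau> | s t :: real. 0 \<le> s \<and> s < 1 \<and> 0 \<le> t \<and> t < 1}
     - puncture_reps \<tau> u"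

text \<open>
  A 1-form on the punctured torus is represented by its coefficient \<open>f\<close> in \<open>f(w) dw\<close>, where
  \<open>w\<close> is the coordinate of \<open>\<complex>\<close>: since \<open>dw\<close> is translation invariant, forms on the quotient
  correspond to lattice-periodic \<open>f\<close> on the complement of the representatives of the puncture.
  There \<open>f\<close> carries no information; it is set to 0 so that equality of
  functions is equality of forms.
\<close>

definition holomorphic_forms :: "complex \<Rightarrow> complex \<Rightarrow> (complex \<Rightarrow> complex) set" where
  "holomorphic_forms \<tau> u =
     {f. f holomorphic_on (- puncture_reps \<tau> u) \<and>
         (\<forall>z \<in> - puncture_reps \<tau> u. \<forall>l \<in> torus_lattice \<tau>. f (z + l) = f z) \<and>
         (\<forall>z \<in> puncture_reps \<tau> u. f z = 0)}"

text \<open>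
  The pairing of \<open>f dw\<close> and \<open>g dw\<close>, i.e. \<open>i\<close> times the integral over the punctured torus of the
  wedge product of \<open>f dw\<close> with the conjugate of \<open>g dw\<close>. The factor 2 arises because \<open>i\<close> times
  the wedge product of \<open>dw\<close> and its conjugate is twice Lebesgue area.
\<close>

definition form_inner ::
    "complex \<Rightarrow> complex \<Rightarrow> (complex \<Rightarrow> complex) \<Rightarrow> (complex \<Rightarrow> complex) \<Rightarrow> complex" where
  "form_inner \<tau> u f g =
     2 * set_lebesgue_integral lborel (fundamental_cell \<tau> u) (\<lambda>w. f w * cnj (g w))"

definition form_norm :: "complex \<Rightarrow> complex \<Rightarrow> (complex \<Rightarrow> complex) \<Rightarrow> real" where
  "form_norm \<tau> u f = sqrt (Re (form_inner \<tau> u f f))"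

definition square_integrable_forms :: "complex \<Rightarrow> complex \<Rightarrow> (complex \<Rightarrow> complex) set" where
  "square_integrable_forms \<tau> u =
     {f \<in> holomorphic_forms \<tau> u.
        set_integrable lborel (fundamental_cell \<tau> u) (\<lambda>w. (cmod (f w))\<^sup>2)}"

text \<open>Orthonormal basis in the Hilbert space sense: finite linear combinations are dense.\<close>

definition orthonormal_basis_forms ::
    "complex \<Rightarrow> complex \<Rightarrow> (complex \<Rightarrow> complex) set \<Rightarrow> bool" where
  "orthonormal_basis_forms \<tau> u B \<longleftrightarrow>
     B \<subseteq> square_integrable_forms \<tau> u \<and>
     (\<forall>f\<in>B. \<forall>g\<in>B. form_inner \<tau> u f g = (if f = g then 1 else 0)) \<and>
     (\<forall>f\<in>square_integrable_forms \<tau> u. \<forall>\<epsilon>>0. \<exists>F a. finite F \<and> F \<subseteq> B \<and>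
        form_norm \<tau> u (\<lambda>w. f w - (\<Sum>b\<in>F. a b * b w)) < \<epsilon>)"

text \<open>
  The definite description means that an orthonormal basis exists and that the
  sum does not depend on its choice.
\<close>

definition bergman_density :: "complex \<Rightarrow> complex \<Rightarrow> complex \<Rightarrow> real" where
  "bergman_density \<tau> u w =
     (THE k. \<exists>B. orthonormal_basis_forms \<tau> u B \<and> ((\<lambda>f. (cmod (f w))\<^sup>2) has_sum k) B)"

text \<open>
  The parameter is \<open>\<tau>\<close> rather than the nome \<open>q\<close>, since the branch of \<open>q\<close> to the power 1/4 is
  fixed by \<open>\<tau>\<close>. The infinite product over \<open>n \<ge> 1\<close> is indexed by \<open>Suc n\<close>.
\<close>

definition theta1 :: "complex \<Rightarrow> complex \<Rightarrow> complex" where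
  "theta1 \<tau> z =
     (let q = exp (of_real pi * \<i> * \<tau>) in
      2 * exp (of_real pi * \<i> * \<tau> / 4) * sin (of_real pi * z) *
      (\<Prod>n. (1 - q ^ (2 * Suc n)) *
            (1 - 2 * cos (2 * of_real pi * z) * q ^ (2 * Suc n) + q ^ (4 * Suc n))))"

text \<open>
  In general this potential is lattice-periodic neither in \<open>z\<close> nor in the pole \<open>w\<close>; it is
  attached to the chosen representatives in \<open>\<complex>\<close>, as is the density formed from it.
\<close>

definition evans_selberg_potential ::
    "complex \<Rightarrow> complex \<Rightarrow> complex \<Rightarrow> complex \<Rightarrow> real" where
  "evans_selberg_potential \<tau> u w z = ln (cmod (theta1 \<tau> (z - w) / theta1 \<tau> (z - u)))"

definition fundamental_density :: "complex \<Rightarrow> complex \<Rightarrow> complex \<Rightarrow> real" where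
  "fundamental_density \<tau> u w =
     exp (Lim (at w) (\<lambda>z. evans_selberg_potential \<tau> u w z - ln (cmod (z - w))))"

end

theory Submission
  imports Defs
begin

text \<open>
  Both densities can be computed near the puncture, and the asymptotics is then a quotient.

  \<^bold>\<open>Bergman kernel.\<close> Removing a point from the torus creates no new square-integrable
  holomorphic form. If \<open>f\<close> is holomorphic and square integrable on a punctured disc about \<open>p\<close>,
  then Cauchy's formula for \<open>f\<^sup>2\<close>, averaged over squares about \<open>z\<close> of size comparable to
  \<open>\<bar>z - p\<bar>\<close>, bounds \<open>\<bar>(z - p) f z\<bar>\<^sup>2\<close> by the integral of \<open>\<bar>f\<bar>\<^sup>2\<close> over a disc that shrinks to
  \<open>p\<close> (\<open>holomorphic_norm_le_square_integral\<close>, \<open>tendsto_0_of_square_integrable\<close>). So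
  \<open>(z - p) f z\<close> tends to 0, the singularity is removable, and \<open>f\<close> extends to a doubly periodic
  entire function, which is constant by Liouville's theorem
  (\<open>square_integrable_form_constant\<close>). The space of forms is therefore spanned by \<open>dw\<close>, whose
  squared norm is twice the area \<open>Im \<tau>\<close> of a period parallelogram, and the Bergman density is the
  constant \<open>1 / (2 Im \<tau>)\<close> off the puncture (\<open>bergman_density_eq\<close>).

  \<^bold>\<open>Fundamental metric.\<close> The sine in \<open>\<theta>\<^sub>1\<close> has a simple zero at 0, and the infinite product is
  continuous and nonzero there, so \<open>\<theta>\<^sub>1(z) = z g(z)\<close> with \<open>g\<close> continuous near 0 and
  \<open>g(0) \<noteq> 0\<close> (\<open>theta1_linear_factor\<close>). The limit defining the metric can then be read off:
  the density at \<open>w\<close> is \<open>\<bar>g(0)\<bar> / (\<bar>w - u\<bar> \<bar>g(w - u)\<bar>)\<close> (\<open>fundamental_density_eq\<close>).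

  Consequently the ratio \<open>\<pi> k / c\<^sup>2\<close> equals
  \<open>\<pi> \<bar>w - u\<bar>\<^sup>2 / (2 Im \<tau>)\<close> times \<open>\<bar>g(w - u) / g(0)\<bar>\<^sup>2\<close>, and the last factor tends to 1.
\<close>

section \<open>Area integrals in the complex plane\<close>

lemma lborel_complex_eq_distr:
  "(lborel :: complex measure) = distr (lborel \<Otimes>\<^sub>M lborel) borel (\<lambda>(x, y). Complex x y)"
proof (rule lborel_eqI)
  fix l u :: complex
  assume "\<And>b. b \<in> Basis \<Longrightarrow> l \<bullet> b \<le> u \<bullet> b"
  from this[of 1] this[of \<i>] have le: "Re l \<le> Re u" "Im l \<le> Im u"
    by (auto simp: Basis_complex_def inner_complex_def)
  have m: "(\<lambda>(x, y). Complex x y) \<in> borel_measurable (lborel \<Otimes>\<^sub>M lborel)"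
    by (simp add: borel_measurable_complex_iff case_prod_unfold)
  have "(\<lambda>(x, y). Complex x y) -` box l u \<inter> space (lborel \<Otimes>\<^sub>M lborel)
      = {Re l<..<Re u} \<times> {Im l<..<Im u}"
    by (auto simp: in_box_complex_iff space_pair_measure)
  then have "emeasure (distr (lborel \<Otimes>\<^sub>M lborel) borel (\<lambda>(x, y). Complex x y)) (box l u)
      = emeasure (lborel \<Otimes>\<^sub>M lborel) ({Re l<..<Re u} \<times> {Im l<..<Im u})"
    by (simp add: emeasure_distr[OF m])
  also have "\<dots> = ennreal ((Re u - Re l) * (Im u - Im l))"
    using le by (subst lborel.emeasure_pair_measure_Times) (auto simp: ennreal_mult)
  also have "(Re u - Re l) * (Im u - Im l) = (\<Prod>b\<in>Basis. (u - l) \<bullet> b)"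
    by (simp add: Basis_complex_def inner_complex_def)
  finally show "emeasure (distr (lborel \<Otimes>\<^sub>M lborel) borel (\<lambda>(x, y). Complex x y)) (box l u)
      = ennreal (\<Prod>b\<in>Basis. (u - l) \<bullet> b)" .
qed simp

text \<open>
  Fubini's theorem in Cartesian coordinates, in both orders. It gives the area of a period
  parallelogram and turns averages of side integrals of squares into area integrals.
\<close>

lemma nn_integral_lborel_complex:
  fixes F :: "complex \<Rightarrow> ennreal"
  assumes [measurable]: "F \<in> borel_measurable borel"
  shows "(\<integral>\<^sup>+ z. F z \<partial>lborel) = (\<integral>\<^sup>+ x. \<integral>\<^sup>+ y. F (Complex x y) \<partial>lborel \<partial>lborel)"
    and "(\<integral>\<^sup>+ z. F z \<partial>lborel) = (\<integral>\<^sup>+ y. \<integral>\<^sup>+ x. F (Complex x y) \<partial>lborel \<partial>lborel)"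
proof -
  have m [measurable]: "(\<lambda>(x, y). Complex x y) \<in> borel_measurable (lborel \<Otimes>\<^sub>M lborel)"
    by (simp add: borel_measurable_complex_iff case_prod_unfold)
  have "(\<integral>\<^sup>+ z. F z \<partial>lborel) = (\<integral>\<^sup>+ p. F (case p of (x, y) \<Rightarrow> Complex x y) \<partial>(lborel \<Otimes>\<^sub>M lborel))"
    by (subst lborel_complex_eq_distr, rule nn_integral_distr) simp_all
  also have "\<dots> = (\<integral>\<^sup>+ (x, y). F (Complex x y) \<partial>(lborel \<Otimes>\<^sub>M lborel))"
    by (simp add: case_prod_unfold)
  finally have *: "(\<integral>\<^sup>+ z. F z \<partial>lborel) = (\<integral>\<^sup>+ (x, y). F (Complex x y) \<partial>(lborel \<Otimes>\<^sub>M lborel))" .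
  have [measurable]: "(\<lambda>(x, y). F (Complex x y)) \<in> borel_measurable (lborel \<Otimes>\<^sub>M lborel)"
    using measurable_compose[OF m assms] by (simp add: case_prod_unfold)
  show "(\<integral>\<^sup>+ z. F z \<partial>lborel) = (\<integral>\<^sup>+ x. \<integral>\<^sup>+ y. F (Complex x y) \<partial>lborel \<partial>lborel)"
    unfolding * by (subst lborel.nn_integral_fst[symmetric]) auto
  show "(\<integral>\<^sup>+ z. F z \<partial>lborel) = (\<integral>\<^sup>+ y. \<integral>\<^sup>+ x. F (Complex x y) \<partial>lborel \<partial>lborel)"
    unfolding * by (subst lborel_pair.nn_integral_snd[symmetric]) auto
qed

lemma nn_integral_lborel_translate:
  fixes F :: "'a::euclidean_space \<Rightarrow> ennreal"
  assumes "F \<in> borel_measurable borel"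
  shows "(\<integral>\<^sup>+ z. F (c + z) \<partial>lborel) = (\<integral>\<^sup>+ z. F z \<partial>lborel)"
proof -
  have "(\<integral>\<^sup>+ z. F z \<partial>distr lborel borel ((+) c)) = (\<integral>\<^sup>+ z. F (c + z) \<partial>lborel)"
    using assms by (intro nn_integral_distr) auto
  then show ?thesis
    by (simp add: lborel_distr_plus)
qed

text \<open>
  Segments are parametrised by arc length \<open>t\<close> from the midpoint \<open>c\<close> in the direction \<open>e\<close>, so that
  the sides of concentric squares are traced at unit speed and the bound can be integrated over the
  size of the square by Fubini's theorem.
\<close>

lemma norm_contour_integral_linepath_le_nn_integral:
  fixes c e :: complex
  assumes r: "r > 0" and e: "cmod e = 1"
    and cont: "continuous_on (closed_segment (c - of_real r * e) (c + of_real r * e)) g"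
  shows "ennreal (cmod (contour_integral (linepath (c - of_real r * e) (c + of_real r * e)) g))
      \<le> (\<integral>\<^sup>+ t. ennreal (cmod (g (c + of_real t * e))) * indicator {-r..r} t \<partial>lborel)"
proof -
  \<comment> \<open>The parameter \<open>x\<close> of the path on \<open>[0, 1]\<close> corresponds to \<open>t = - r + 2 r x\<close>.\<close>
  define a where "a = c - of_real r * e"
  define b where "b = c + of_real r * e"
  have param: "linepath a b x = c + of_real (- r + 2 * r * x) * e" for x
    by (simp add: linepath_def a_def b_def scaleR_conv_of_real algebra_simps)
  have ba: "cmod (b - a) = 2 * r"
    using r e by (simp add: a_def b_def norm_mult)
  have contx: "continuous_on {0..1} (\<lambda>x. g (linepath a b x))"
    using cont unfolding a_def[symmetric] b_def[symmetric]
    by (intro continuous_on_compose2[OF _ continuous_on_linepath])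
       (auto simp: linepath_in_path)
  have "contour_integral (linepath a b) g = integral {0..1} (\<lambda>x. g (linepath a b x) * (b - a))"
    by (simp add: contour_integral_integral)
  moreover have "cmod (integral {0..1} (\<lambda>x. g (linepath a b x) * (b - a)))
      \<le> integral {0..1} (\<lambda>x. 2 * r * cmod (g (linepath a b x)))"
    by (intro integral_norm_bound_integral integrable_continuous_real continuous_intros contx)
       (simp add: norm_mult ba)
  ultimately have "ennreal (cmod (contour_integral (linepath a b) g))
      \<le> ennreal (integral {0..1} (\<lambda>x. 2 * r * cmod (g (linepath a b x))))"
    by (simp add: ennreal_leI)
  also have "\<dots> = (\<integral>\<^sup>+ x. ennreal (2 * r * cmod (g (linepath a b x))) * indicator {0..1} x \<partial>lborel)"
  proof (rule nn_integral_has_integral_lebesgue'[symmetric])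
    show "((\<lambda>x. 2 * r * cmod (g (linepath a b x))) has_integral
        integral {0..1} (\<lambda>x. 2 * r * cmod (g (linepath a b x)))) {0..1}"
      by (intro integrable_integral integrable_continuous_real continuous_intros contx)
  qed (use r in auto)
  also have "\<dots> = (\<integral>\<^sup>+ x. 2 * r * (ennreal (cmod (g (linepath a b x))) * indicator {0..1} x) \<partial>lborel)"
    using r by (simp add: ennreal_mult mult.assoc)
  also have "\<dots> = 2 * r * (\<integral>\<^sup>+ x. ennreal (cmod (g (linepath a b x))) * indicator {0..1} x \<partial>lborel)"
  proof (rule nn_integral_cmult)
    have "(\<lambda>x. indicator {0..1} x *\<^sub>R cmod (g (linepath a b x))) \<in> borel_measurable borel"
      by (intro borel_measurable_continuous_on_indicator continuous_intros contx) auto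
    then have "(\<lambda>x. ennreal (indicator {0..1} x *\<^sub>R cmod (g (linepath a b x)))) \<in> borel_measurable borel"
      by measurable
    also have "(\<lambda>x. ennreal (indicator {0..1} x *\<^sub>R cmod (g (linepath a b x)))) =
        (\<lambda>x. ennreal (cmod (g (linepath a b x))) * indicator {0..1} x)"
      by (auto simp: fun_eq_iff indicator_def)
    finally show "(\<lambda>x. ennreal (cmod (g (linepath a b x))) * indicator {0..1} x)
        \<in> borel_measurable lborel"
      by simp
  qed
  also have "\<dots> = (\<integral>\<^sup>+ t. ennreal (cmod (g (c + of_real t * e))) * indicator {-r..r} t \<partial>lborel)"
  proof -
    let ?f = "\<lambda>t. ennreal (cmod (g (c + of_real t * e))) * indicator {-r..r} t"
    have contt: "continuous_on {-r..r} (\<lambda>t. g (c + of_real t * e))"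
    proof (rule continuous_on_compose2[OF cont])
      show "(\<lambda>t. c + of_real t * e) ` {-r..r} \<subseteq> closed_segment (c - of_real r * e) (c + of_real r * e)"
      proof
        fix z assume "z \<in> (\<lambda>t. c + of_real t * e) ` {-r..r}"
        then obtain t where t: "t \<in> {-r..r}" "z = c + of_real t * e" by auto
        have "z = linepath a b ((t + r) / (2 * r))"
          unfolding param using r t by (simp add: field_simps)
        moreover have "(t + r) / (2 * r) \<in> {0..1}"
          using r t by (simp add: field_simps)
        ultimately show "z \<in> closed_segment (c - of_real r * e) (c + of_real r * e)"
          using linepath_in_path a_def b_def by blast
      qed
    qed (intro continuous_intros)
    have "(\<lambda>t. indicator {-r..r} t *\<^sub>R cmod (g (c + of_real t * e))) \<in> borel_measurable borel"
      by (intro borel_measurable_continuous_on_indicator continuous_intros contt) auto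
    then have "(\<lambda>t. ennreal (indicator {-r..r} t *\<^sub>R cmod (g (c + of_real t * e)))) \<in> borel_measurable borel"
      by measurable
    also have "(\<lambda>t. ennreal (indicator {-r..r} t *\<^sub>R cmod (g (c + of_real t * e)))) = ?f"
      by (auto simp: fun_eq_iff indicator_def)
    finally have "?f \<in> borel_measurable borel" .
    from nn_integral_real_affine[OF this, of "2 * r" "- r"]
    have "(\<integral>\<^sup>+ t. ?f t \<partial>lborel) = ennreal (2 * r) * (\<integral>\<^sup>+ x. ?f (- r + 2 * r * x) \<partial>lborel)"
      using r by simp
    moreover have "?f (- r + 2 * r * x) = ennreal (cmod (g (linepath a b x))) * indicator {0..1} x" for x
      using r by (auto simp: indicator_def param zero_le_mult_iff)
    ultimately show ?thesis by simp
  qed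
  finally show ?thesis
    unfolding a_def b_def .
qed

section \<open>An area mean value inequality for holomorphic functions\<close>

lemma measurable_Complex [measurable]:
  assumes [measurable]: "f \<in> borel_measurable M" "g \<in> borel_measurable M"
  shows "(\<lambda>x. Complex (f x) (g x)) \<in> borel_measurable M"
  by (simp add: borel_measurable_complex_iff)

lemma borel_measurable_cnj [measurable]: "cnj \<in> borel_measurable borel"
  by (intro borel_measurable_continuous_onI continuous_intros)

lemma nn_integral_lborel_complex_cnj:
  fixes F :: "complex \<Rightarrow> ennreal"
  assumes [measurable]: "F \<in> borel_measurable borel"
  shows "(\<integral>\<^sup>+ z. F (cnj z) \<partial>lborel) = (\<integral>\<^sup>+ z. F z \<partial>lborel)"
proof -
  have "(\<integral>\<^sup>+ z. F (cnj z) \<partial>lborel) = (\<integral>\<^sup>+ y. \<integral>\<^sup>+ x. F (Complex x (- y)) \<partial>lborel \<partial>lborel)"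
    by (subst nn_integral_lborel_complex(2)) (auto simp: complex_cnj)
  also have "\<dots> = (\<integral>\<^sup>+ y. \<integral>\<^sup>+ x. F (Complex x y) \<partial>lborel \<partial>lborel)"
    by (subst (2) nn_integral_real_affine[where c = "-1" and t = 0]) auto
  finally show ?thesis
    by (simp add: nn_integral_lborel_complex(2)[of F])
qed

lemma nn_integral_lborel_complex_ii:
  fixes F :: "complex \<Rightarrow> ennreal"
  assumes [measurable]: "F \<in> borel_measurable borel"
  shows "(\<integral>\<^sup>+ z. F (\<i> * z) \<partial>lborel) = (\<integral>\<^sup>+ z. F z \<partial>lborel)"
proof -
  have i: "\<i> * Complex x y = Complex (- y) x" for x y
    by (simp add: complex_eq_iff)
  have "(\<integral>\<^sup>+ z. F (\<i> * z) \<partial>lborel) = (\<integral>\<^sup>+ y. \<integral>\<^sup>+ x. F (Complex (- y) x) \<partial>lborel \<partial>lborel)"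
    by (subst nn_integral_lborel_complex(2)) (auto simp: i)
  also have "\<dots> = (\<integral>\<^sup>+ y. \<integral>\<^sup>+ x. F (Complex y x) \<partial>lborel \<partial>lborel)"
    by (subst (2) nn_integral_real_affine[where c = "-1" and t = 0]) auto
  finally show ?thesis
    by (simp add: nn_integral_lborel_complex(1)[of F])
qed

text \<open>
  The four sides of a square are exchanged by the quarter turns, so that invariance of area under
  the powers of \<open>\<i>\<close> reduces each of them to the bottom side.
\<close>

lemma nn_integral_lborel_complex_unit:
  fixes F :: "complex \<Rightarrow> ennreal"
  assumes F [measurable]: "F \<in> borel_measurable borel"
  shows "(\<integral>\<^sup>+ z. F (\<i> ^ k * z) \<partial>lborel) = (\<integral>\<^sup>+ z. F z \<partial>lborel)"
proof (induction k)
  case (Suc k)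
  have [measurable]: "(\<lambda>z. F (\<i> ^ k * z)) \<in> borel_measurable borel"
    by measurable
  have "(\<integral>\<^sup>+ z. F (\<i> ^ k * (\<i> * z)) \<partial>lborel) = (\<integral>\<^sup>+ z. F (\<i> ^ k * z) \<partial>lborel)"
    by (rule nn_integral_lborel_complex_ii) measurable
  then show ?case
    using Suc.IH by (simp add: mult_ac)
qed simp

text \<open>
  Cauchy's formula on the square of half-side \<open>r\<close> about \<open>z\<close>. The side number \<open>k\<close> is the bottom side,
  with points \<open>z + t - \<i> r\<close>, turned \<open>k\<close> times by a right angle about \<open>z\<close>; written this way, the
  four side integrals have the same shape.
\<close>

lemma Cauchy_integral_formula_square_le:
  fixes z :: complex
  assumes r: "r > 0" and hol: "h holomorphic_on S"
    and sub: "cbox (z - Complex r r) (z + Complex r r) \<subseteq> S"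
  shows "ennreal (2 * pi * cmod (h z))
    \<le> (\<Sum>k<4. \<integral>\<^sup>+ t. ennreal (cmod (h (z + \<i> ^ k * Complex t (- r)) / (\<i> ^ k * Complex t (- r))))
          * indicator {-r..r} t \<partial>lborel)"
proof -
  define Q where "Q = cbox (z - Complex r r) (z + Complex r r)"
  define g where "g = (\<lambda>w. h w / (w - z))"
  define e where "e = (\<lambda>k::nat. \<i> ^ k)"
  \<comment> \<open>Side \<open>k\<close> has midpoint \<open>z - \<i> r e\<close> and direction \<open>e = \<i>\<^sup>k\<close>.\<close>
  define a where "a = (\<lambda>k. z - \<i> * of_real r * e k - of_real r * e k)"
  define b where "b = (\<lambda>k. z - \<i> * of_real r * e k + of_real r * e k)"
  have ab: "b k = a (Suc k)" for k
    by (simp add: a_def b_def e_def algebra_simps)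
  have a4: "a (Suc (Suc (Suc (Suc 0)))) = a 0"
    by (simp add: a_def e_def)
  have rp: "rectpath (z - Complex r r) (z + Complex r r) =
      linepath (a 0) (b 0) +++ linepath (a 1) (b 1) +++ linepath (a 2) (b 2) +++ linepath (a 3) (b 3)"
    unfolding rectpath_def Let_def
    by (intro arg_cong2[of _ _ _ _ "(+++)"] arg_cong2[of _ _ _ _ linepath])
       (simp_all add: a_def b_def e_def complex_eq_iff numeral_2_eq_2 numeral_3_eq_3)
  have zin: "z \<in> box (z - Complex r r) (z + Complex r r)"
    using r by (simp add: in_box_complex_iff)
  have img: "path_image (rectpath (z - Complex r r) (z + Complex r r)) \<subseteq> Q - {z}"
    using zin r unfolding Q_def
    by (subst path_image_rectpath_cbox_minus_box) auto
  have hci: "(g has_contour_integral 2 * pi * \<i> * winding_number (rectpath (z - Complex r r) (z + Complex r r)) z * h z)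
      (rectpath (z - Complex r r) (z + Complex r r))"
    unfolding g_def
  proof (rule Cauchy_integral_formula_convex_simple[where S = Q])
    show "h holomorphic_on Q"
      using hol sub unfolding Q_def by (rule holomorphic_on_subset)
    show "z \<in> interior Q"
      using zin by (simp add: Q_def interior_cbox)
  qed (use img in \<open>auto simp: Q_def convex_box\<close>)
  have seg: "closed_segment (a k) (b k) \<subseteq> Q - {z}" if "k < 4" for k
    using img that unfolding rp
    by (auto simp: path_image_join ab numeral_2_eq_2 numeral_3_eq_3 a4 less_Suc_eq numeral_eq_Suc)
  have cont: "continuous_on (Q - {z}) g"
    unfolding g_def
    using holomorphic_on_imp_continuous_on[OF hol] sub
    by (intro continuous_intros) (auto simp: Q_def intro: continuous_on_subset)
  have int: "g contour_integrable_on linepath (a k) (b k)" if "k < 4" for k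
    by (intro contour_integrable_continuous_linepath continuous_on_subset[OF cont seg] that)
  have "2 * pi * \<i> * h z = contour_integral (rectpath (z - Complex r r) (z + Complex r r)) g"
    using contour_integral_unique[OF hci] winding_number_rectpath[OF zin] by simp
  also have "\<dots> = (\<Sum>k<4. contour_integral (linepath (a k) (b k)) g)"
    unfolding rp using int[of 0] int[of 1] int[of 2] int[of 3]
    by (simp add: ab numeral_2_eq_2 numeral_3_eq_3 a4 numeral_eq_Suc)
  finally have formula: "2 * pi * \<i> * h z = (\<Sum>k<4. contour_integral (linepath (a k) (b k)) g)" .
  have "2 * pi * cmod (h z) = cmod (2 * pi * \<i> * h z)"
    by (simp add: norm_mult)
  also have "\<dots> = cmod (\<Sum>k<4. contour_integral (linepath (a k) (b k)) g)"
    by (simp only: formula)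
  also have "\<dots> \<le> (\<Sum>k<4. cmod (contour_integral (linepath (a k) (b k)) g))"
    by (rule norm_sum)
  finally have "ennreal (2 * pi * cmod (h z)) \<le> (\<Sum>k<4. ennreal (cmod (contour_integral (linepath (a k) (b k)) g)))"
    by (simp add: ennreal_leI)
  also have "\<dots> \<le> (\<Sum>k<4. \<integral>\<^sup>+ t. ennreal (cmod (h (z + \<i> ^ k * Complex t (- r)) / (\<i> ^ k * Complex t (- r))))
          * indicator {-r..r} t \<partial>lborel)"
  proof (rule sum_mono)
    fix k :: nat assume "k \<in> {..<4}"
    then have k: "k < 4" by simp
    have pt: "z - \<i> * of_real r * e k + of_real t * e k = z + \<i> ^ k * Complex t (- r)" for t
      by (simp add: e_def Complex_eq algebra_simps)
    have "ennreal (cmod (contour_integral (linepath (a k) (b k)) g))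
      \<le> (\<integral>\<^sup>+ t. ennreal (cmod (g (z - \<i> * of_real r * e k + of_real t * e k))) * indicator {-r..r} t \<partial>lborel)"
      unfolding a_def b_def
      by (rule norm_contour_integral_linepath_le_nn_integral[OF r])
         (use continuous_on_subset[OF cont seg[OF k]] in \<open>auto simp: e_def norm_power a_def b_def\<close>)
    then show "ennreal (cmod (contour_integral (linepath (a k) (b k)) g)) \<le>
        (\<integral>\<^sup>+ t. ennreal (cmod (h (z + \<i> ^ k * Complex t (- r)) / (\<i> ^ k * Complex t (- r))))
          * indicator {-r..r} t \<partial>lborel)"
      unfolding pt by (simp add: g_def)
  qed
  finally show ?thesis .
qed

text \<open>
  An area mean value inequality. Cauchy's formula bounds \<open>2 \<pi> \<bar>h z\<bar>\<close> by \<open>1 / r\<close> times the integral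
  of \<open>\<bar>h\<bar>\<close> over the boundary of the square of half-side \<open>r\<close>. Integrating over \<open>r\<close> from \<open>s / 2\<close> to
  \<open>s\<close>, where \<open>1 / r \<le> 2 / s\<close>, each of the four sides sweeps out a part of the square of half-side
  \<open>s\<close> and contributes at most the area integral. Squares take the place of discs because this uses
  Fubini's theorem in Cartesian coordinates only. The constant 4 is not optimal.
\<close>

lemma holomorphic_norm_le_square_integral:
  fixes z :: complex
  assumes s: "s > 0" and hol: "h holomorphic_on S"
    and sub: "cbox (z - Complex s s) (z + Complex s s) \<subseteq> S"
  shows "ennreal (s\<^sup>2 * cmod (h z))
    \<le> 4 * (\<integral>\<^sup>+ w. ennreal (cmod (h w)) * indicator (cbox (z - Complex s s) (z + Complex s s)) w \<partial>lborel)"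
proof -
  define Q where "Q = cbox (z - Complex s s) (z + Complex s s)"
  define \<Phi> where "\<Phi> = (\<lambda>w. ennreal (cmod (h w)) * indicator Q w)"
  have "continuous_on Q h"
    using holomorphic_on_imp_continuous_on[OF hol] sub continuous_on_subset unfolding Q_def by blast
  then have "(\<lambda>w. indicator Q w *\<^sub>R cmod (h w)) \<in> borel_measurable borel"
    by (intro borel_measurable_continuous_on_indicator continuous_intros) (auto simp: Q_def)
  then have "(\<lambda>w. ennreal (indicator Q w *\<^sub>R cmod (h w))) \<in> borel_measurable borel"
    by measurable
  also have "(\<lambda>w. ennreal (indicator Q w *\<^sub>R cmod (h w))) = \<Phi>"
    by (auto simp: fun_eq_iff indicator_def \<Phi>_def)
  finally have \<Phi> [measurable]: "\<Phi> \<in> borel_measurable borel" .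
  define J where "J = (\<lambda>k r. \<integral>\<^sup>+ t. \<Phi> (z + \<i> ^ k * Complex t (- r)) \<partial>lborel)"
  have [measurable]: "J k \<in> borel_measurable borel" for k
    unfolding J_def by measurable
  \<comment> \<open>The bound for one \<open>r\<close>; \<open>J k r\<close> is the integral of \<open>\<Phi>\<close> over the whole line containing side \<open>k\<close>.\<close>
  have slice: "ennreal (2 * pi * cmod (h z)) \<le> ennreal (2 / s) * (\<Sum>k<4. J k r)"
    if r: "s / 2 \<le> r" "r \<le> s" for r
  proof -
    have r0: "r > 0" using r s by simp
    have "cbox (z - Complex r r) (z + Complex r r) \<subseteq> S"
      using sub r by (force simp: in_cbox_complex_iff)
    from Cauchy_integral_formula_square_le[OF r0 hol this]
    have "ennreal (2 * pi * cmod (h z))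
      \<le> (\<Sum>k<4. \<integral>\<^sup>+ t. ennreal (cmod (h (z + \<i> ^ k * Complex t (- r)) / (\<i> ^ k * Complex t (- r))))
          * indicator {-r..r} t \<partial>lborel)" .
    also have "\<dots> \<le> (\<Sum>k<4. \<integral>\<^sup>+ t. ennreal (2 / s) * \<Phi> (z + \<i> ^ k * Complex t (- r)) \<partial>lborel)"
    proof (intro sum_mono nn_integral_mono)
      fix k :: nat and t :: real
      assume "k \<in> {..<4}"
      then have k: "k \<in> {0, 1, 2, 3}" by auto
      show "ennreal (cmod (h (z + \<i> ^ k * Complex t (- r)) / (\<i> ^ k * Complex t (- r)))) * indicator {-r..r} t
         \<le> ennreal (2 / s) * \<Phi> (z + \<i> ^ k * Complex t (- r))"
      proof (cases "t \<in> {-r..r}")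
        case True
        have Q: "z + \<i> ^ k * Complex t (- r) \<in> Q"
          using k True r by (auto simp: Q_def in_cbox_complex_iff numeral_2_eq_2 numeral_3_eq_3)
        have "r \<le> cmod (Complex t (- r))"
          using abs_Im_le_cmod[of "Complex t (- r)"] r0 by simp
        then have "cmod (h (z + \<i> ^ k * Complex t (- r)) / (\<i> ^ k * Complex t (- r)))
            \<le> cmod (h (z + \<i> ^ k * Complex t (- r))) / (s / 2)"
          unfolding norm_divide norm_mult norm_power
          using r r0 s by (intro frac_le) auto
        then show ?thesis
          using True Q s by (simp add: \<Phi>_def ennreal_leI mult.commute flip: ennreal_mult)
      qed simp
    qed
    also have "\<dots> = ennreal (2 / s) * (\<Sum>k<4. J k r)"
      unfolding J_def by (simp add: nn_integral_cmult sum_distrib_left)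
    finally show ?thesis .
  qed
  \<comment> \<open>As \<open>r\<close> varies, these lines sweep out the plane, and \<open>\<Phi>\<close> vanishes outside the large square.\<close>
  have J: "(\<integral>\<^sup>+ r. J k r \<partial>lborel) = (\<integral>\<^sup>+ w. \<Phi> w \<partial>lborel)" for k
  proof -
    have "(\<integral>\<^sup>+ r. J k r \<partial>lborel) = (\<integral>\<^sup>+ w. \<Phi> (z + \<i> ^ k * cnj w) \<partial>lborel)"
      unfolding J_def
      by (subst nn_integral_lborel_complex(2)) (auto simp: complex_cnj)
    also have "\<dots> = (\<integral>\<^sup>+ w. \<Phi> (z + \<i> ^ k * w) \<partial>lborel)"
      by (rule nn_integral_lborel_complex_cnj) measurable
    also have "\<dots> = (\<integral>\<^sup>+ w. \<Phi> (z + w) \<partial>lborel)"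
      by (rule nn_integral_lborel_complex_unit) measurable
    also have "\<dots> = (\<integral>\<^sup>+ w. \<Phi> w \<partial>lborel)"
      by (rule nn_integral_lborel_translate) measurable
    finally show ?thesis .
  qed
  have "ennreal (2 * pi * cmod (h z)) * ennreal (s / 2)
      = (\<integral>\<^sup>+ r. ennreal (2 * pi * cmod (h z)) * indicator {s / 2..s} r \<partial>lborel)"
    using s by (subst nn_integral_cmult_indicator) auto
  also have "\<dots> \<le> (\<integral>\<^sup>+ r. ennreal (2 / s) * (\<Sum>k<4. J k r) \<partial>lborel)"
    by (intro nn_integral_mono) (use slice in \<open>auto simp: indicator_def\<close>)
  also have "\<dots> = ennreal (2 / s) * (\<Sum>k<4. \<integral>\<^sup>+ r. J k r \<partial>lborel)"
    by (simp add: nn_integral_cmult nn_integral_sum)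
  also have "\<dots> = ennreal (2 / s) * (4 * (\<integral>\<^sup>+ w. \<Phi> w \<partial>lborel))"
    by (simp add: J)
  finally have main: "ennreal (2 * pi * cmod (h z)) * ennreal (s / 2) \<le> ennreal (2 / s) * (4 * (\<integral>\<^sup>+ w. \<Phi> w \<partial>lborel))" .
  have "ennreal (s\<^sup>2 * cmod (h z)) \<le> ennreal (s / 2 * (2 * pi * cmod (h z) * (s / 2)))"
  proof (rule ennreal_leI)
    have "s\<^sup>2 * cmod (h z) * 1 \<le> s\<^sup>2 * cmod (h z) * (pi / 2)"
      using pi_ge_two by (intro mult_left_mono) auto
    then show "s\<^sup>2 * cmod (h z) \<le> s / 2 * (2 * pi * cmod (h z) * (s / 2))"
      by (simp add: power2_eq_square field_simps)
  qed
  also have "\<dots> = ennreal (s / 2) * (ennreal (2 * pi * cmod (h z)) * ennreal (s / 2))"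
    using s by (simp flip: ennreal_mult)
  also have "\<dots> \<le> ennreal (s / 2) * (ennreal (2 / s) * (4 * (\<integral>\<^sup>+ w. \<Phi> w \<partial>lborel)))"
    by (rule mult_left_mono[OF main]) simp
  also have "\<dots> = 4 * (\<integral>\<^sup>+ w. \<Phi> w \<partial>lborel)"
    using s by (simp add: mult.assoc[symmetric] flip: ennreal_mult)
  finally show ?thesis
    unfolding \<Phi>_def Q_def .
qed

section \<open>The period lattice and its cell\<close>

lemma torus_lattice_iff: "l \<in> torus_lattice \<tau> \<longleftrightarrow> (\<exists>m n. l = of_int m + of_int n * \<tau>)"
  by (auto simp: torus_lattice_def)

lemma torus_lattice_diff:
  assumes "k \<in> torus_lattice \<tau>" "l \<in> torus_lattice \<tau>"
  shows "k - l \<in> torus_lattice \<tau>"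
proof -
  from assms obtain m n m' n' where "k = of_int m + of_int n * \<tau>" "l = of_int m' + of_int n' * \<tau>"
    by (auto simp: torus_lattice_iff)
  then have "k - l = of_int (m - m') + of_int (n - n') * \<tau>"
    by (simp add: algebra_simps)
  then show ?thesis
    unfolding torus_lattice_iff by blast
qed

lemma torus_lattice_0 [simp]: "0 \<in> torus_lattice \<tau>"
  unfolding torus_lattice_iff by (intro exI[of _ 0]) simp

lemma torus_lattice_minus: "l \<in> torus_lattice \<tau> \<Longrightarrow> - l \<in> torus_lattice \<tau>"
  using torus_lattice_diff[OF torus_lattice_0] by fastforce

lemma puncture_reps_iff: "z \<in> puncture_reps \<tau> u \<longleftrightarrow> z - u \<in> torus_lattice \<tau>"
proof -
  have "z \<in> puncture_reps \<tau> u \<longleftrightarrow> (\<exists>l. z = u + l \<and> l \<in> torus_lattice \<tau>)"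
    by (auto simp: puncture_reps_def)
  also have "\<dots> \<longleftrightarrow> z - u \<in> torus_lattice \<tau>"
    by (metis add_diff_cancel_left' add.commute diff_add_cancel)
  finally show ?thesis .
qed

lemma puncture_reps_translate:
  assumes l: "l \<in> torus_lattice \<tau>"
  shows "z + l \<in> puncture_reps \<tau> u \<longleftrightarrow> z \<in> puncture_reps \<tau> u"
proof -
  have "z - u \<in> torus_lattice \<tau>" if "z + l - u \<in> torus_lattice \<tau>"
    using torus_lattice_diff[OF that l] by (simp add: algebra_simps)
  moreover have "z + l - u \<in> torus_lattice \<tau>" if "z - u \<in> torus_lattice \<tau>"
    using torus_lattice_diff[OF that torus_lattice_minus[OF l]] by (simp add: algebra_simps)
  ultimately show ?thesis
    by (auto simp: puncture_reps_iff)
qed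

lemma torus_lattice_discrete:
  assumes "Im \<tau> > 0" "l \<in> torus_lattice \<tau>" "cmod l < min 1 (Im \<tau>)"
  shows "l = 0"
proof -
  obtain m n where l: "l = of_int m + of_int n * \<tau>"
    using assms(2) by (auto simp: torus_lattice_iff)
  have "\<bar>of_int n * Im \<tau>\<bar> \<le> cmod l"
    using abs_Im_le_cmod[of l] by (simp add: l)
  moreover have "\<bar>of_int n * Im \<tau>\<bar> = \<bar>of_int n\<bar> * Im \<tau>"
    using assms by (simp add: abs_mult)
  ultimately have "\<bar>of_int n\<bar> * Im \<tau> < 1 * Im \<tau>"
    using assms(3) by linarith
  then have "\<bar>of_int n :: real\<bar> < 1"
    using assms(1) mult_less_cancel_right_pos by blast
  then have n: "n = 0"
    by linarith
  then have "\<bar>of_int m :: real\<bar> < 1"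
    using assms abs_Re_le_cmod[of l] by (simp add: l)
  then have "m = 0"
    by linarith
  with n show ?thesis
    by (simp add: l)
qed

text \<open>
  A nonzero lattice element has modulus at least \<open>min 1 (Im \<tau>)\<close>, so this radius isolates each
  representative of the puncture from all others.
\<close>

lemma puncture_reps_isolated:
  assumes "Im \<tau> > 0" "p \<in> puncture_reps \<tau> u" "z \<in> puncture_reps \<tau> u" "dist z p < min 1 (Im \<tau>)"
  shows "z = p"
proof -
  have "z - p \<in> torus_lattice \<tau>"
    using torus_lattice_diff[of "z - u" \<tau> "p - u"] assms by (simp add: puncture_reps_iff)
  from torus_lattice_discrete[OF assms(1) this] show ?thesis
    using assms(4) by (simp add: dist_norm)
qed

lemma closed_puncture_reps:
  assumes "Im \<tau> > 0"
  shows "closed (puncture_reps \<tau> u)"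
  using puncture_reps_isolated[OF assms] assms
  by (intro discrete_imp_closed[of "min 1 (Im \<tau>)"]) auto

lemma countable_puncture_reps: "countable (puncture_reps \<tau> u)"
proof -
  have "puncture_reps \<tau> u \<subseteq> (\<lambda>(m, n). u + (of_int m + of_int n * \<tau>)) ` UNIV"
    by (auto simp: puncture_reps_def torus_lattice_def)
  then show ?thesis
    by (rule countable_subset) simp
qed

text \<open>
  The period parallelogram with the puncture kept: unlike the fundamental cell, its shape does not
  depend on \<open>u\<close>.
\<close>

definition period_cell :: "complex \<Rightarrow> complex set" where
  "period_cell \<tau> = {of_real s + of_real t * \<tau> | s t :: real. 0 \<le> s \<and> s < 1 \<and> 0 \<le> t \<and> t < 1}"

lemma fundamental_cell_eq: "fundamental_cell \<tau> u = period_cell \<tau> - puncture_reps \<tau> u"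
  by (simp add: fundamental_cell_def period_cell_def)

text \<open>
  In the real basis \<open>1, \<tau>\<close> the coordinates of \<open>z\<close> are \<open>Re z - (Im z / Im \<tau>) Re \<tau>\<close> and
  \<open>Im z / Im \<tau>\<close>; their integer parts translate \<open>z\<close> into the cell.
\<close>

lemma period_cell_iff:
  assumes "Im \<tau> > 0"
  shows "z \<in> period_cell \<tau> \<longleftrightarrow>
    Im z / Im \<tau> \<in> {0..<1} \<and> Re z - Im z / Im \<tau> * Re \<tau> \<in> {0..<1}"
proof
  assume "z \<in> period_cell \<tau>"
  then show "Im z / Im \<tau> \<in> {0..<1} \<and> Re z - Im z / Im \<tau> * Re \<tau> \<in> {0..<1}"
    using assms by (auto simp: period_cell_def)
next
  assume *: "Im z / Im \<tau> \<in> {0..<1} \<and> Re z - Im z / Im \<tau> * Re \<tau> \<in> {0..<1}"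
  have z: "z = of_real (Re z - Im z / Im \<tau> * Re \<tau>) + of_real (Im z / Im \<tau>) * \<tau>"
    using assms by (simp add: complex_eq_iff)
  show "z \<in> period_cell \<tau>"
    unfolding period_cell_def by (intro CollectI exI conjI, rule z) (use * in auto)
qed

lemma period_cell_borel:
  assumes "Im \<tau> > 0"
  shows "period_cell \<tau> \<in> sets borel"
proof -
  have "period_cell \<tau> = {z. Im z / Im \<tau> \<in> {0..<1} \<and> Re z - Im z / Im \<tau> * Re \<tau> \<in> {0..<1}}"
    using period_cell_iff[OF assms] by blast
  also have "\<dots> \<in> sets borel"
    by measurable
  finally show ?thesis .
qed

lemma exists_period_cell_translate:
  assumes "Im \<tau> > 0"
  shows "z - (of_int \<lfloor>Re z - Im z / Im \<tau> * Re \<tau>\<rfloor> + of_int \<lfloor>Im z / Im \<tau>\<rfloor> * \<tau>) \<in> period_cell \<tau>"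
proof -
  define t where "t = Im z / Im \<tau>"
  define x where "x = Re z - t * Re \<tau>"
  define w where "w = z - (of_int \<lfloor>x\<rfloor> + of_int \<lfloor>t\<rfloor> * \<tau>)"
  have "Im z = t * Im \<tau>"
    using assms by (simp add: t_def)
  then have "Im w = (t - of_int \<lfloor>t\<rfloor>) * Im \<tau>"
    by (simp add: w_def algebra_simps)
  then have t: "Im w / Im \<tau> = t - of_int \<lfloor>t\<rfloor>"
    using assms by simp
  have x: "Re w - (t - of_int \<lfloor>t\<rfloor>) * Re \<tau> = x - of_int \<lfloor>x\<rfloor>"
    by (simp add: w_def x_def algebra_simps)
  have frac: "y - of_int \<lfloor>y\<rfloor> \<in> {0..<1}" for y :: real
    unfolding atLeastLessThan_iff by (intro conjI) linarith+
  have "w \<in> period_cell \<tau>"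
    unfolding period_cell_iff[OF assms] t x using frac by blast
  then show ?thesis
    by (simp add: w_def x_def t_def)
qed

lemma bounded_period_cell: "bounded (period_cell \<tau>)"
proof -
  have "cmod z \<le> 1 + cmod \<tau>" if z: "z \<in> period_cell \<tau>" for z
  proof -
    obtain s t where st: "z = of_real s + of_real t * \<tau>" "0 \<le> s" "s < 1" "0 \<le> t" "t < 1"
      using z by (auto simp: period_cell_def)
    have "cmod z \<le> s + t * cmod \<tau>"
      unfolding st(1) using st by (intro norm_triangle_le) (simp add: norm_mult)
    also have "\<dots> \<le> 1 + 1 * cmod \<tau>"
      using st by (intro add_mono mult_right_mono) auto
    finally show ?thesis by simp
  qed
  then show ?thesis
    by (auto simp: bounded_iff)
qed

text \<open>
  The slice of the parallelogram at height \<open>y\<close> is an interval of length 1 for \<open>0 \<le> y < Im \<tau>\<close>, and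
  empty otherwise.
\<close>

lemma emeasure_period_cell:
  assumes \<tau>: "Im \<tau> > 0"
  shows "emeasure lborel (period_cell \<tau>) = ennreal (Im \<tau>)"
proof -
  note [measurable] = period_cell_borel[OF \<tau>]
  have slice: "(\<integral>\<^sup>+ x. indicator (period_cell \<tau>) (Complex x y) \<partial>lborel) = indicator {0..<Im \<tau>} y" for y
  proof -
    define c where "c = y / Im \<tau> * Re \<tau>"
    have "indicator (period_cell \<tau>) (Complex x y) = (indicator {0..<Im \<tau>} y * indicator {c..<1 + c} x :: ennreal)" for x
      using \<tau> by (auto simp: indicator_def period_cell_iff[OF \<tau>] c_def field_simps)
    then have "(\<integral>\<^sup>+ x. indicator (period_cell \<tau>) (Complex x y) \<partial>lborel)
        = (\<integral>\<^sup>+ x. indicator {0..<Im \<tau>} y * indicator {c..<1 + c} x \<partial>lborel)"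
      by simp
    also have "\<dots> = indicator {0..<Im \<tau>} y"
      by (subst nn_integral_cmult_indicator) auto
    finally show ?thesis .
  qed
  have "emeasure lborel (period_cell \<tau>) = (\<integral>\<^sup>+ z. indicator (period_cell \<tau>) z \<partial>lborel)"
    by simp
  also have "\<dots> = (\<integral>\<^sup>+ y. \<integral>\<^sup>+ x. indicator (period_cell \<tau>) (Complex x y) \<partial>lborel \<partial>lborel)"
    by (rule nn_integral_lborel_complex(2)) measurable
  also have "\<dots> = ennreal (Im \<tau>)"
    using \<tau> by (simp add: slice)
  finally show ?thesis .
qed

lemma puncture_reps_null: "puncture_reps \<tau> u \<in> null_sets lborel"
  using countable_puncture_reps by (rule countable_imp_null_set_lborel)

lemma measure_fundamental_cell:
  assumes \<tau>: "Im \<tau> > 0"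
  shows "fundamental_cell \<tau> u \<in> sets lborel" "emeasure lborel (fundamental_cell \<tau> u) = ennreal (Im \<tau>)"
proof -
  note [measurable] = period_cell_borel[OF \<tau>]
  show "fundamental_cell \<tau> u \<in> sets lborel"
    unfolding fundamental_cell_eq using puncture_reps_null[of \<tau> u] by auto
  show "emeasure lborel (fundamental_cell \<tau> u) = ennreal (Im \<tau>)"
    unfolding fundamental_cell_eq emeasure_period_cell[OF \<tau>, symmetric]
    by (rule emeasure_Diff_null_set[OF puncture_reps_null]) simp
qed

text \<open>
  A disc meets only finitely many lattice translates of the cell, each of which carries the same
  integral. This is how a norm defined on one cell controls \<open>f\<close> near the puncture, even when the
  puncture lies on the boundary of the cell.
\<close>

lemma nn_integral_cball_finite_of_periodic:
  fixes F :: "complex \<Rightarrow> ennreal"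
  assumes \<tau>: "Im \<tau> > 0" and F [measurable]: "F \<in> borel_measurable borel"
    and per: "\<And>z l. l \<in> torus_lattice \<tau> \<Longrightarrow> F (z + l) = F z"
    and fin: "(\<integral>\<^sup>+ z. F z * indicator (period_cell \<tau>) z \<partial>lborel) < \<infinity>"
  shows "(\<integral>\<^sup>+ z. F z * indicator (cball p R) z \<partial>lborel) < \<infinity>"
proof -
  note [measurable] = period_cell_borel[OF \<tau>]
  define s where "s = (\<lambda>z. Re z - Im z / Im \<tau> * Re \<tau>)"
  define t where "t = (\<lambda>z. Im z / Im \<tau>)"
  have bdd: "\<exists>B. \<forall>z\<in>cball p R. \<bar>g z\<bar> \<le> B" if "continuous_on (cball p R) g" for g :: "complex \<Rightarrow> real"
    using compact_imp_bounded[OF compact_continuous_image[OF that]] by (auto simp: bounded_iff)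
  have "continuous_on (cball p R) s" "continuous_on (cball p R) t"
    using \<tau> unfolding s_def t_def by (auto intro!: continuous_intros)
  then obtain S T where S: "\<And>z. z \<in> cball p R \<Longrightarrow> \<bar>s z\<bar> \<le> S" and T: "\<And>z. z \<in> cball p R \<Longrightarrow> \<bar>t z\<bar> \<le> T"
    using bdd[of s] bdd[of t] by blast
  \<comment> \<open>The integer parts of the coordinates of the points of the disc.\<close>
  define I where "I = {\<lfloor>- S\<rfloor>..\<lfloor>S\<rfloor>} \<times> {\<lfloor>- T\<rfloor>..\<lfloor>T\<rfloor>}"
  define L where "L = (\<lambda>(m, n). of_int m + of_int n * \<tau>) ` I"
  have finL: "finite L"
    by (simp add: L_def I_def)
  have L: "l \<in> torus_lattice \<tau>" if "l \<in> L" for l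
    using that by (auto simp: L_def torus_lattice_def)
  have cover: "\<exists>l\<in>L. z - l \<in> period_cell \<tau>" if z: "z \<in> cball p R" for z
  proof
    have "\<lfloor>s z\<rfloor> \<in> {\<lfloor>- S\<rfloor>..\<lfloor>S\<rfloor>}" "\<lfloor>t z\<rfloor> \<in> {\<lfloor>- T\<rfloor>..\<lfloor>T\<rfloor>}"
      using S[OF z] T[OF z] by (auto intro!: floor_mono)
    then show "of_int \<lfloor>s z\<rfloor> + of_int \<lfloor>t z\<rfloor> * \<tau> \<in> L"
      unfolding L_def I_def by (intro image_eqI[of _ _ "(\<lfloor>s z\<rfloor>, \<lfloor>t z\<rfloor>)"]) auto
    show "z - (of_int \<lfloor>s z\<rfloor> + of_int \<lfloor>t z\<rfloor> * \<tau>) \<in> period_cell \<tau>"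
      using exists_period_cell_translate[OF \<tau>] by (simp add: s_def t_def)
  qed
  have "(\<integral>\<^sup>+ z. F z * indicator (cball p R) z \<partial>lborel)
      \<le> (\<integral>\<^sup>+ z. (\<Sum>l\<in>L. F z * indicator (period_cell \<tau>) (z - l)) \<partial>lborel)"
  proof (rule nn_integral_mono)
    fix z
    show "F z * indicator (cball p R) z \<le> (\<Sum>l\<in>L. F z * indicator (period_cell \<tau>) (z - l))"
    proof (cases "z \<in> cball p R")
      case True
      then obtain l where l: "l \<in> L" "z - l \<in> period_cell \<tau>"
        using cover by blast
      then have "F z * indicator (cball p R) z = F z * indicator (period_cell \<tau>) (z - l)"
        using True by simp
      also have "\<dots> \<le> (\<Sum>l\<in>L. F z * indicator (period_cell \<tau>) (z - l))"
        using l(1) finL by (intro member_le_sum) auto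
      finally show ?thesis .
    qed simp
  qed
  also have "\<dots> = (\<Sum>l\<in>L. \<integral>\<^sup>+ z. F z * indicator (period_cell \<tau>) (z - l) \<partial>lborel)"
    by (rule nn_integral_sum) measurable
  also have "\<dots> = (\<Sum>l\<in>L. \<integral>\<^sup>+ z. F z * indicator (period_cell \<tau>) z \<partial>lborel)"
  proof (rule sum.cong)
    fix l assume l: "l \<in> L"
    have "(\<integral>\<^sup>+ z. F z * indicator (period_cell \<tau>) (z - l) \<partial>lborel)
        = (\<integral>\<^sup>+ z. F (l + z) * indicator (period_cell \<tau>) (l + z - l) \<partial>lborel)"
      by (rule nn_integral_lborel_translate[symmetric]) measurable
    also have "\<dots> = (\<integral>\<^sup>+ z. F z * indicator (period_cell \<tau>) z \<partial>lborel)"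
      using per[OF L[OF l]] by (simp add: add.commute)
    finally show "(\<integral>\<^sup>+ z. F z * indicator (period_cell \<tau>) (z - l) \<partial>lborel)
        = (\<integral>\<^sup>+ z. F z * indicator (period_cell \<tau>) z \<partial>lborel)" .
  qed simp
  also have "\<dots> < \<infinity>"
    using fin by (auto simp: ennreal_mult_less_top sum_constant of_nat_less_top)
  finally show ?thesis .
qed

section \<open>Square-integrable holomorphic forms and the Bergman kernel\<close>

text \<open>
  The measure \<open>\<bar>f\<bar>\<^sup>2 dA\<close> is finite near \<open>p\<close>, so its mass on discs about \<open>p\<close> tends to the mass 0 of
  the point. The mean value inequality for \<open>f\<^sup>2\<close>, on a square about \<open>z\<close> of half-side
  \<open>\<bar>z - p\<bar> / 2\<close>, bounds \<open>\<bar>z - p\<bar>\<^sup>2 \<bar>f z\<bar>\<^sup>2\<close> by 16 times the mass of the disc of radius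
  \<open>2 \<bar>z - p\<bar>\<close>. The limit 0 is the hypothesis of Riemann's theorem on removable singularities.
\<close>

lemma tendsto_0_of_square_integrable:
  fixes f :: "complex \<Rightarrow> complex"
  assumes f [measurable]: "f \<in> borel_measurable borel"
    and R: "R > 0" and hol: "f holomorphic_on (ball p R - {p})"
    and fin: "(\<integral>\<^sup>+ z. ennreal ((cmod (f z))\<^sup>2) * indicator (cball p R) z \<partial>lborel) < \<infinity>"
  shows "((\<lambda>z. (z - p) * f z) \<longlongrightarrow> 0) (at p)"
proof -
  define M where "M = density lborel (\<lambda>z. ennreal ((cmod (f z))\<^sup>2))"
  have M: "emeasure M A = (\<integral>\<^sup>+ z. ennreal ((cmod (f z))\<^sup>2) * indicator A z \<partial>lborel)" if "A \<in> sets borel" for A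
    using that by (simp add: M_def emeasure_density)
  define A where "A = (\<lambda>n. cball p (R / real (Suc n)))"
  have "(\<lambda>n. emeasure M (A n)) \<longlonglongrightarrow> emeasure M (\<Inter>n. A n)"
  proof (rule Lim_emeasure_decseq)
    show "range A \<subseteq> sets M"
      by (auto simp: A_def M_def)
    show "decseq A"
      unfolding A_def decseq_def using R by (auto intro!: divide_left_mono elim!: order_trans simp: mem_cball)
    fix n
    have "R / real (Suc n) \<le> R"
      using R by (simp add: field_simps)
    then have "emeasure M (A n) \<le> emeasure M (cball p R)"
      by (intro emeasure_mono) (auto simp: A_def M_def)
    also have "\<dots> < \<infinity>"
      using fin by (simp add: M)
    finally show "emeasure M (A n) \<noteq> \<infinity>"
      by simp
  qed
  moreover have "(\<Inter>n. A n) = {p}"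
  proof -
    have "z = p" if z: "z \<in> (\<Inter>n. A n)" for z
    proof (rule ccontr)
      assume "z \<noteq> p"
      then have "dist p z > 0" by simp
      then obtain n where "R / dist p z < real n"
        using reals_Archimedean2 by blast
      then have "R < dist p z * real (Suc n)"
        using \<open>dist p z > 0\<close> by (simp add: field_simps add_strict_increasing2)
      moreover have "dist p z \<le> R / real (Suc n)"
        using z by (auto simp: A_def)
      ultimately show False
        by (simp add: field_simps)
    qed
    then show ?thesis
      using R by (auto simp: A_def)
  qed
  moreover have "emeasure M {p} = 0"
  proof -
    have "emeasure M {p} = (\<integral>\<^sup>+ z. ennreal ((cmod (f z))\<^sup>2) * indicator {p} z \<partial>lborel)"
      by (simp add: M)
    also have "\<dots> = (\<integral>\<^sup>+ z. ennreal ((cmod (f p))\<^sup>2) * indicator {p} z \<partial>lborel)"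
      by (intro nn_integral_cong) (auto simp: indicator_def)
    also have "\<dots> = 0"
      by (simp add: nn_integral_cmult_indicator)
    finally show ?thesis .
  qed
  ultimately have lim: "(\<lambda>n. emeasure M (A n)) \<longlonglongrightarrow> 0"
    by simp
  show ?thesis
    unfolding tendsto_iff
  proof (intro allI impI)
    fix e :: real assume e: "e > 0"
    have "eventually (\<lambda>n. emeasure M (A n) < ennreal (e\<^sup>2 / 16)) sequentially"
      using lim e by (intro order_tendstoD) auto
    then obtain n where n: "emeasure M (A n) < ennreal (e\<^sup>2 / 16)"
      using eventually_happens'[OF sequentially_bot] by blast
    define \<delta> where "\<delta> = R / real (Suc n) / 2"
    have \<delta>: "\<delta> > 0" "2 * \<delta> \<le> R" "A n = cball p (2 * \<delta>)"
      using R by (auto simp: \<delta>_def A_def field_simps)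
    have "cmod ((z - p) * f z) < e" if z: "z \<noteq> p" "dist z p < \<delta>" for z
    proof -
      define d where "d = dist z p"
      define Q where "Q = cbox (z - Complex (d / 2) (d / 2)) (z + Complex (d / 2) (d / 2))"
      have d: "d > 0" "d < \<delta>"
        using z by (auto simp: d_def)
      \<comment> \<open>With half-side \<open>d / 2\<close> the half-diagonal is less than \<open>d\<close>, so the square misses \<open>p\<close>.\<close>
      have Qz: "dist w z < d" if w: "w \<in> Q" for w
      proof -
        have "\<bar>Re (w - z)\<bar> \<le> d / 2" "\<bar>Im (w - z)\<bar> \<le> d / 2"
          using w unfolding Q_def in_cbox_complex_iff abs_le_iff
          by (simp_all add: diff_le_eq)
        then have "(Re (w - z))\<^sup>2 \<le> (d / 2)\<^sup>2" "(Im (w - z))\<^sup>2 \<le> (d / 2)\<^sup>2"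
          using d by (simp_all add: power2_le_iff_abs_le del: power2_diff)
        then have "(cmod (w - z))\<^sup>2 \<le> d\<^sup>2 / 2"
          by (simp add: cmod_power2 power_divide)
        also have "\<dots> < d\<^sup>2"
          using d by simp
        finally show ?thesis
          using d by (simp add: dist_norm power2_less_imp_less)
      qed
      have Qp: "Q \<subseteq> ball p R - {p}" "Q \<subseteq> A n"
      proof -
        show "Q \<subseteq> A n"
        proof
          fix w assume "w \<in> Q"
          then have "dist w p < d + d"
            using Qz[of w] dist_triangle[of w p z] by (simp add: d_def)
          then show "w \<in> A n"
            using d by (simp add: \<delta>(3) dist_commute)
        qed
        show "Q \<subseteq> ball p R - {p}"
        proof
          fix w assume w: "w \<in> Q"
          then have "dist w p < d + d"
            using Qz[of w] dist_triangle[of w p z] by (simp add: d_def)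
          moreover have "w \<noteq> p"
            using Qz[OF w] by (auto simp: d_def dist_commute)
          ultimately show "w \<in> ball p R - {p}"
            using d \<delta>(2) by (simp add: dist_commute)
        qed
      qed
      have "(\<lambda>w. (f w)\<^sup>2) holomorphic_on (ball p R - {p})"
        using hol by (intro holomorphic_intros)
      from holomorphic_norm_le_square_integral[OF _ this, of "d / 2" z] d Qp(1)
      have "ennreal ((d / 2)\<^sup>2 * cmod ((f z)\<^sup>2))
          \<le> 4 * (\<integral>\<^sup>+ w. ennreal (cmod ((f w)\<^sup>2)) * indicator Q w \<partial>lborel)"
        by (simp add: Q_def)
      also have "(\<integral>\<^sup>+ w. ennreal (cmod ((f w)\<^sup>2)) * indicator Q w \<partial>lborel) = emeasure M Q"
        by (subst M) (auto simp: Q_def norm_power)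
      also have "emeasure M Q \<le> emeasure M (A n)"
        using Qp(2) by (intro emeasure_mono) (auto simp: A_def M_def)
      also have "4 * emeasure M (A n) < ennreal (4 * (e\<^sup>2 / 16))"
      proof -
        have "4 * emeasure M (A n) < 4 * ennreal (e\<^sup>2 / 16)"
          using n by (intro ennreal_mult_strict_left_mono) auto
        also have "4 * ennreal (e\<^sup>2 / 16) = ennreal (4 * (e\<^sup>2 / 16))"
          using ennreal_mult[of 4 "e\<^sup>2 / 16"] by simp
        finally show ?thesis .
      qed
      finally have "(d / 2)\<^sup>2 * cmod ((f z)\<^sup>2) < 4 * (e\<^sup>2 / 16)"
        by (simp add: ennreal_less_iff mult_left_mono)
      then have "(d * cmod (f z))\<^sup>2 < e\<^sup>2"
        by (simp add: power_mult_distrib power_divide norm_power)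
      then have "d * cmod (f z) < e"
        using e by (simp add: power2_less_imp_less)
      then show ?thesis
        by (simp add: norm_mult d_def dist_norm)
    qed
    then show "eventually (\<lambda>z. dist ((z - p) * f z) 0 < e) (at p)"
      unfolding eventually_at using \<delta>(1) by auto
  qed
qed

text \<open>
  The convention that forms vanish at the representatives of the puncture, a lattice-invariant set,
  makes periodicity hold at every point of the plane.
\<close>

lemma holomorphic_forms_periodic:
  assumes "f \<in> holomorphic_forms \<tau> u" "l \<in> torus_lattice \<tau>"
  shows "f (z + l) = f z"
  using assms puncture_reps_translate[OF assms(2), of z u]
  by (cases "z \<in> puncture_reps \<tau> u") (auto simp: holomorphic_forms_def)

lemma holomorphic_forms_borel:
  assumes \<tau>: "Im \<tau> > 0" and f: "f \<in> holomorphic_forms \<tau> u"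
  shows "f \<in> borel_measurable borel"
proof -
  have "(\<lambda>z. indicator (- puncture_reps \<tau> u) z *\<^sub>R f z) \<in> borel_measurable borel"
    using f closed_puncture_reps[OF \<tau>, of u]
    by (intro borel_measurable_continuous_on_indicator)
       (auto simp: holomorphic_forms_def intro: holomorphic_on_imp_continuous_on)
  also have "(\<lambda>z. indicator (- puncture_reps \<tau> u) z *\<^sub>R f z) = f"
    using f by (auto simp: fun_eq_iff indicator_def holomorphic_forms_def)
  finally show ?thesis .
qed

lemma square_integrable_form_nn_integral_cball:
  assumes \<tau>: "Im \<tau> > 0" and f: "f \<in> square_integrable_forms \<tau> u"
  shows "(\<integral>\<^sup>+ z. ennreal ((cmod (f z))\<^sup>2) * indicator (cball p R) z \<partial>lborel) < \<infinity>"
proof (rule nn_integral_cball_finite_of_periodic[OF \<tau>])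
  have fh: "f \<in> holomorphic_forms \<tau> u"
    using f by (simp add: square_integrable_forms_def)
  show "(\<lambda>z. ennreal ((cmod (f z))\<^sup>2)) \<in> borel_measurable borel"
    using holomorphic_forms_borel[OF \<tau> fh] by measurable
  show "ennreal ((cmod (f (z + l)))\<^sup>2) = ennreal ((cmod (f z))\<^sup>2)" if "l \<in> torus_lattice \<tau>" for z l
    using holomorphic_forms_periodic[OF fh that] by simp
  have "integrable lborel (\<lambda>z. indicator (fundamental_cell \<tau> u) z *\<^sub>R (cmod (f z))\<^sup>2)"
    using f by (simp add: square_integrable_forms_def set_integrable_def)
  then have "(\<integral>\<^sup>+ z. ennreal (norm (indicator (fundamental_cell \<tau> u) z *\<^sub>R (cmod (f z))\<^sup>2)) \<partial>lborel) < \<infinity>"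
    by (simp add: integrable_iff_bounded)
  also have "(\<lambda>z. ennreal (norm (indicator (fundamental_cell \<tau> u) z *\<^sub>R (cmod (f z))\<^sup>2)))
      = (\<lambda>z. ennreal ((cmod (f z))\<^sup>2) * indicator (period_cell \<tau>) z)"
    using fh by (auto simp: fun_eq_iff indicator_def fundamental_cell_eq holomorphic_forms_def)
  finally show "(\<integral>\<^sup>+ z. ennreal ((cmod (f z))\<^sup>2) * indicator (period_cell \<tau>) z \<partial>lborel) < \<infinity>" .
qed

text \<open>
  The extension is defined everywhere by the limit of \<open>f\<close>, without case distinction, so that it
  inherits periodicity from \<open>f\<close> also at the punctures.
\<close>

lemma square_integrable_form_extends_entire:
  assumes \<tau>: "Im \<tau> > 0" and f: "f \<in> square_integrable_forms \<tau> u"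
  obtains F where "F holomorphic_on UNIV" "\<And>z. z \<notin> puncture_reps \<tau> u \<Longrightarrow> F z = f z"
    "\<And>z l. l \<in> torus_lattice \<tau> \<Longrightarrow> F (z + l) = F z"
proof
  define P where "P = puncture_reps \<tau> u"
  have fh: "f \<in> holomorphic_forms \<tau> u"
    using f by (simp add: square_integrable_forms_def)
  then have hol: "f holomorphic_on (- P)"
    by (simp add: holomorphic_forms_def P_def)
  have op: "open (- P)"
    using closed_puncture_reps[OF \<tau>] by (simp add: P_def open_Compl)
  define F where "F = (\<lambda>z. Lim (at z) f)"
  have F_eq: "F z = f z" if "z \<notin> P" for z
  proof -
    have "isCont f z"
      using continuous_on_interior[OF holomorphic_on_imp_continuous_on[OF hol]] that op
      by (simp add: interior_open)
    then show ?thesis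
      unfolding F_def isCont_def by (intro tendsto_Lim) simp_all
  qed
  then show "F z = f z" if "z \<notin> puncture_reps \<tau> u" for z
    using that by (simp add: P_def)
  show "F (z + l) = F z" if "l \<in> torus_lattice \<tau>" for z l
  proof -
    have "filtermap f (at (z + l)) = filtermap f (at z)"
      using holomorphic_forms_periodic[OF fh that]
      by (simp add: at_to_0[of "z + l"] at_to_0[of z] filtermap_filtermap add.assoc[symmetric])
    then show ?thesis
      unfolding F_def Topological_Spaces.Lim_def filterlim_def by simp
  qed
  have "F field_differentiable at p" for p
  proof (cases "p \<in> P")
    case False
    then obtain f' where "(f has_field_derivative f') (at p)"
      using hol by (auto simp: holomorphic_on_open[OF op])
    then have "(F has_field_derivative f') (at p)"
      by (rule has_field_derivative_transform_within_open[OF _ op]) (use False F_eq in auto)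
    then show ?thesis
      by (auto simp: field_differentiable_def)
  next
    case True
    define R where "R = min 1 (Im \<tau>)"
    have R: "R > 0"
      using \<tau> by (simp add: R_def)
    have sub: "ball p R - {p} \<subseteq> - P"
      using puncture_reps_isolated[OF \<tau>, of p u] True by (auto simp: P_def R_def dist_commute)
    then have hol': "f holomorphic_on (ball p R - {p})"
      using hol holomorphic_on_subset by blast
    have "((\<lambda>z. (z - p) * f z) \<longlongrightarrow> 0) (at p)"
      by (intro tendsto_0_of_square_integrable[OF _ R hol'] holomorphic_forms_borel[OF \<tau> fh]
            square_integrable_form_nn_integral_cball[OF \<tau> f])
    then obtain g where g: "g holomorphic_on ball p R" "\<And>z. z \<in> ball p R - {p} \<Longrightarrow> g z = f z"
      using holomorphic_on_extend_lim[OF hol'] R by (auto simp: interior_open)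
    have Fg: "F z = g z" if z: "z \<in> ball p R" for z
    proof (cases "z = p")
      case False
      then show ?thesis
        using z g(2) sub F_eq by auto
    next
      case True
      have "isCont g p"
        using continuous_on_interior[OF holomorphic_on_imp_continuous_on[OF g(1)]] R
        by (simp add: interior_open)
      then have "(g \<longlongrightarrow> g p) (at p)"
        by (simp add: isCont_def)
      moreover have "eventually (\<lambda>z. g z = f z) (at p)"
        using g(2) R eventually_at_ball'[OF R, of p UNIV] by (auto elim!: eventually_mono)
      ultimately have "(f \<longlongrightarrow> g p) (at p)"
        by (rule Lim_transform_eventually)
      then show ?thesis
        unfolding F_def True by (intro tendsto_Lim) simp_all
    qed
    obtain g' where "(g has_field_derivative g') (at p)"
      using g(1) R by (force simp: holomorphic_on_open)
    then have "(F has_field_derivative g') (at p)"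
      by (rule has_field_derivative_transform_within_open[of _ _ _ "ball p R"]) (use R Fg in auto)
    then show ?thesis
      by (auto simp: field_differentiable_def)
  qed
  then show "F holomorphic_on UNIV"
    by (simp add: holomorphic_on_def field_differentiable_at_within)
qed

definition constant_form :: "complex \<Rightarrow> complex \<Rightarrow> complex \<Rightarrow> complex \<Rightarrow> complex" where
  "constant_form \<tau> u c = (\<lambda>z. if z \<in> puncture_reps \<tau> u then 0 else c)"

text \<open>
  By periodicity the entire extension takes all its values on the closure of one cell, which is
  compact; Liouville's theorem applies.
\<close>

lemma square_integrable_form_constant:
  assumes \<tau>: "Im \<tau> > 0" and f: "f \<in> square_integrable_forms \<tau> u"
  obtains c where "f = constant_form \<tau> u c"
proof -
  obtain F where F: "F holomorphic_on UNIV" "\<And>z. z \<notin> puncture_reps \<tau> u \<Longrightarrow> F z = f z"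
      "\<And>z l. l \<in> torus_lattice \<tau> \<Longrightarrow> F (z + l) = F z"
    using square_integrable_form_extends_entire[OF \<tau> f] by blast
  have "range F \<subseteq> F ` closure (period_cell \<tau>)"
  proof
    fix y assume "y \<in> range F"
    then obtain z where y: "y = F z" by blast
    define l where "l = of_int \<lfloor>Re z - Im z / Im \<tau> * Re \<tau>\<rfloor> + of_int \<lfloor>Im z / Im \<tau>\<rfloor> * \<tau>"
    have "z - l \<in> period_cell \<tau>"
      unfolding l_def by (rule exists_period_cell_translate[OF \<tau>])
    moreover have "l \<in> torus_lattice \<tau>"
      unfolding l_def torus_lattice_iff by blast
    then have "F z = F (z - l)"
      using F(3)[of l "z - l"] by simp
    ultimately show "y \<in> F ` closure (period_cell \<tau>)"
      using y closure_subset by blast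
  qed
  moreover have "bounded (F ` closure (period_cell \<tau>))"
    using bounded_period_cell F(1) holomorphic_on_imp_continuous_on
    by (intro compact_imp_bounded compact_continuous_image)
       (auto intro: continuous_on_subset simp: compact_closure)
  ultimately have "bounded (range F)"
    using bounded_subset by blast
  then have "F constant_on UNIV"
    using Liouville_theorem F(1) by blast
  then obtain c where c: "\<And>z. F z = c"
    by (auto simp: constant_on_def)
  have "f z = constant_form \<tau> u c z" for z
    using f F(2)[of z] c by (auto simp: constant_form_def square_integrable_forms_def holomorphic_forms_def)
  then show thesis
    using that by blast
qed

lemma constant_form_square_integrable:
  assumes \<tau>: "Im \<tau> > 0"
  shows "constant_form \<tau> u c \<in> square_integrable_forms \<tau> u"
proof -
  have "constant_form \<tau> u c holomorphic_on (- puncture_reps \<tau> u)"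
    by (rule holomorphic_transform[of "\<lambda>_. c"]) (auto simp: constant_form_def)
  then have "constant_form \<tau> u c \<in> holomorphic_forms \<tau> u"
    by (auto simp: holomorphic_forms_def constant_form_def puncture_reps_translate)
  moreover have "set_integrable lborel (fundamental_cell \<tau> u) (\<lambda>w. (cmod (constant_form \<tau> u c w))\<^sup>2)"
  proof -
    have "set_integrable lborel (fundamental_cell \<tau> u) (\<lambda>w. (cmod c)\<^sup>2)"
      unfolding set_integrable_def using measure_fundamental_cell[OF \<tau>, of u]
      by (intro integrable_scaleR_left integrable_real_indicator) auto
    then show ?thesis
      by (rule set_integrable_cong[THEN iffD1, rotated -1])
         (auto simp: constant_form_def fundamental_cell_eq)
  qed
  ultimately show ?thesis
    by (simp add: square_integrable_forms_def)
qed

lemma form_inner_constant_form: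
  assumes \<tau>: "Im \<tau> > 0"
  shows "form_inner \<tau> u (constant_form \<tau> u c) (constant_form \<tau> u d) = 2 * of_real (Im \<tau>) * (c * cnj d)"
proof -
  have m: "measure lborel (fundamental_cell \<tau> u) = Im \<tau>"
    using measure_fundamental_cell[OF \<tau>, of u] \<tau> by (simp add: measure_def)
  have "set_lebesgue_integral lborel (fundamental_cell \<tau> u) (\<lambda>w. constant_form \<tau> u c w * cnj (constant_form \<tau> u d w))
      = set_lebesgue_integral lborel (fundamental_cell \<tau> u) (\<lambda>w. c * cnj d)"
    using measure_fundamental_cell[OF \<tau>, of u]
    by (intro set_lebesgue_integral_cong) (auto simp: constant_form_def fundamental_cell_eq)
  also have "\<dots> = Im \<tau> *\<^sub>R (c * cnj d)"
    unfolding set_lebesgue_integral_def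
    using measure_fundamental_cell[OF \<tau>, of u] by (simp add: m)
  finally show ?thesis
    by (simp add: form_inner_def scaleR_conv_of_real)
qed

lemma form_norm_constant_form:
  assumes \<tau>: "Im \<tau> > 0"
  shows "form_norm \<tau> u (constant_form \<tau> u c) = sqrt (2 * Im \<tau>) * cmod c"
proof -
  have "Re (form_inner \<tau> u (constant_form \<tau> u c) (constant_form \<tau> u c)) = 2 * Im \<tau> * (cmod c)\<^sup>2"
    unfolding form_inner_constant_form[OF \<tau>] complex_norm_square[symmetric] by simp
  then show ?thesis
    by (simp add: form_norm_def real_sqrt_mult)
qed

text \<open>
  The space of forms is one-dimensional: an orthonormal basis cannot be empty, since \<open>dw\<close> has
  positive norm, and two distinct members would be orthogonal nonzero multiples of the same form.
\<close>

lemma orthonormal_basis_forms_iff: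
  assumes \<tau>: "Im \<tau> > 0"
  shows "orthonormal_basis_forms \<tau> u B \<longleftrightarrow>
    (\<exists>c. B = {constant_form \<tau> u c} \<and> (cmod c)\<^sup>2 = 1 / (2 * Im \<tau>))"
proof
  assume B: "orthonormal_basis_forms \<tau> u B"
  then have sq: "B \<subseteq> square_integrable_forms \<tau> u"
    and orth: "\<And>f g. f \<in> B \<Longrightarrow> g \<in> B \<Longrightarrow> form_inner \<tau> u f g = (if f = g then 1 else 0)"
    and dense: "\<And>f \<epsilon>. f \<in> square_integrable_forms \<tau> u \<Longrightarrow> \<epsilon> > 0 \<Longrightarrow>
        \<exists>F a. finite F \<and> F \<subseteq> B \<and> form_norm \<tau> u (\<lambda>w. f w - (\<Sum>b\<in>F. a b * b w)) < \<epsilon>"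
    unfolding orthonormal_basis_forms_def by blast+
  have nz: "c * cnj d = (if constant_form \<tau> u c = constant_form \<tau> u d then 1 / (2 * Im \<tau>) else 0)"
    if "constant_form \<tau> u c \<in> B" "constant_form \<tau> u d \<in> B" for c d
    using orth[OF that] \<tau> unfolding form_inner_constant_form[OF \<tau>]
    by (auto simp: field_simps split: if_splits)
  have "B \<noteq> {}"
  proof
    assume "B = {}"
    then have "form_norm \<tau> u (constant_form \<tau> u 1) < sqrt (2 * Im \<tau>)"
      using dense[OF constant_form_square_integrable[OF \<tau>, of u 1], of "sqrt (2 * Im \<tau>)"] \<tau> by auto
    then show False
      by (simp add: form_norm_constant_form[OF \<tau>])
  qed
  then obtain f where "f \<in> B" by blast
  then obtain c where c: "constant_form \<tau> u c \<in> B"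
    using sq square_integrable_form_constant[OF \<tau>] by blast
  have c2: "c * cnj c = of_real (1 / (2 * Im \<tau>))"
    using nz[OF c c] by simp
  have "g = constant_form \<tau> u c" if g: "g \<in> B" for g
  proof -
    obtain d where d: "g = constant_form \<tau> u d"
      using sq g square_integrable_form_constant[OF \<tau>] by blast
    have "d * cnj d \<noteq> 0" "c * cnj c \<noteq> 0"
      using nz[of d d] nz[OF c c] g d \<tau> by auto
    then have "c * cnj d \<noteq> 0"
      by simp
    then show ?thesis
      using nz[OF c, of d] g d by (auto split: if_splits)
  qed
  then have "B = {constant_form \<tau> u c}"
    using c by blast
  moreover have "(cmod c)\<^sup>2 = 1 / (2 * Im \<tau>)"
    using c2 unfolding complex_norm_square[symmetric] of_real_eq_iff by simp
  ultimately show "\<exists>c. B = {constant_form \<tau> u c} \<and> (cmod c)\<^sup>2 = 1 / (2 * Im \<tau>)"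
    by blast
next
  assume "\<exists>c. B = {constant_form \<tau> u c} \<and> (cmod c)\<^sup>2 = 1 / (2 * Im \<tau>)"
  then obtain c where B: "B = {constant_form \<tau> u c}" and c: "(cmod c)\<^sup>2 = 1 / (2 * Im \<tau>)"
    by blast
  have c0: "c \<noteq> 0"
    using c \<tau> by auto
  show "orthonormal_basis_forms \<tau> u B"
    unfolding orthonormal_basis_forms_def
  proof (intro conjI ballI allI impI)
    show "B \<subseteq> square_integrable_forms \<tau> u"
      using B constant_form_square_integrable[OF \<tau>] by simp
    show "form_inner \<tau> u f g = (if f = g then 1 else 0)" if "f \<in> B" "g \<in> B" for f g
      using that \<tau> unfolding B
      by (simp add: form_inner_constant_form[OF \<tau>] complex_norm_square[symmetric] c)
    fix f and \<epsilon> :: real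
    assume f: "f \<in> square_integrable_forms \<tau> u" and \<epsilon>: "\<epsilon> > 0"
    obtain d where d: "f = constant_form \<tau> u d"
      using square_integrable_form_constant[OF \<tau> f] .
    have "(\<lambda>w. f w - (\<Sum>b\<in>B. d / c * b w)) = constant_form \<tau> u 0"
      using c0 by (auto simp: B d constant_form_def fun_eq_iff)
    then have "form_norm \<tau> u (\<lambda>w. f w - (\<Sum>b\<in>B. d / c * b w)) < \<epsilon>"
      using \<epsilon> by (simp add: form_norm_constant_form[OF \<tau>])
    then show "\<exists>F a. finite F \<and> F \<subseteq> B \<and> form_norm \<tau> u (\<lambda>w. f w - (\<Sum>b\<in>F. a b * b w)) < \<epsilon>"
      by (intro exI[of _ B] exI[of _ "\<lambda>_. d / c"]) (simp add: B)
  qed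
qed

text \<open>
  Orthonormal bases differ only in the phase of their single member, which the squared modulus
  forgets; hence the definite description in the Bergman density has a value.
\<close>

lemma bergman_density_eq:
  assumes \<tau>: "Im \<tau> > 0" and w: "w \<notin> puncture_reps \<tau> u"
  shows "bergman_density \<tau> u w = 1 / (2 * Im \<tau>)"
proof -
  have *: "((\<lambda>f. (cmod (f w))\<^sup>2) has_sum k) {constant_form \<tau> u c} \<longleftrightarrow> k = (cmod c)\<^sup>2" for k c
    using has_sum_finite[of "{constant_form \<tau> u c}" "\<lambda>f. (cmod (f w))\<^sup>2"] w has_sum_unique
    by (force simp: constant_form_def)
  have "cmod (of_real (sqrt (1 / (2 * Im \<tau>)))) ^ 2 = 1 / (2 * Im \<tau>)"
    using \<tau> by (simp del: of_real_divide real_sqrt_divide)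
  then have ex: "\<exists>c. (cmod c)\<^sup>2 = 1 / (2 * Im \<tau>)"
    by blast
  have "(\<exists>B. orthonormal_basis_forms \<tau> u B \<and> ((\<lambda>f. (cmod (f w))\<^sup>2) has_sum k) B) \<longleftrightarrow> k = 1 / (2 * Im \<tau>)" for k
    unfolding orthonormal_basis_forms_iff[OF \<tau>] using ex * by metis
  then show ?thesis
    by (simp add: bergman_density_def)
qed

section \<open>The theta function and the fundamental metric\<close>

definition theta_product :: "complex \<Rightarrow> complex \<Rightarrow> complex" where
  "theta_product q z =
     (\<Prod>n. (1 - q ^ (2 * Suc n)) *
            (1 - 2 * cos (2 * of_real pi * z) * q ^ (2 * Suc n) + q ^ (4 * Suc n)))"

text \<open>
  For bounded cosine the factors differ from 1 by at most a constant times \<open>\<bar>q\<bar>\<^sup>n\<close>, so the product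
  converges uniformly on compact sets.
\<close>

lemma continuous_on_theta_product:
  assumes q: "cmod q < 1" and K: "compact K"
  shows "continuous_on K (theta_product q)"
proof -
  define a where "a = (\<lambda>n z. (1 - q ^ (2 * Suc n)) *
            (1 - 2 * cos (2 * of_real pi * z) * q ^ (2 * Suc n) + q ^ (4 * Suc n)))"
  have cont: "continuous_on K (a n)" for n
    unfolding a_def by (intro continuous_intros)
  have "continuous_on K (\<lambda>z. cos (2 * of_real pi * z))"
    by (intro continuous_intros)
  then have "bounded ((\<lambda>z. cos (2 * of_real pi * z)) ` K)"
    using K compact_continuous_image compact_imp_bounded by blast
  then obtain C where C: "\<And>z. z \<in> K \<Longrightarrow> cmod (cos (2 * of_real pi * z)) \<le> C" and C0: "C > 0"
    by (force simp: bounded_pos)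
  define M where "M = 2 * (2 * C + 1) + 1"
  have bound: "norm (norm (a n z - 1)) \<le> M * cmod q ^ n" if z: "z \<in> K" for n z
  proof -
    define x where "x = q ^ (2 * Suc n)"
    define c where "c = cos (2 * of_real pi * z)"
    have x4: "q ^ (4 * Suc n) = x\<^sup>2"
      unfolding x_def power_mult[symmetric] by (rule arg_cong[where f = "power q"]) simp
    have x1: "cmod x \<le> 1"
      unfolding x_def norm_power using q by (intro power_le_one) auto
    have xq: "cmod x \<le> cmod q ^ n"
      unfolding x_def norm_power using q by (intro power_decreasing) auto
    have c: "cmod c \<le> C"
      using C z by (simp add: c_def)
    have "a n z - 1 = x * ((1 - x) * (x - 2 * c) - 1)"
      unfolding a_def x4 x_def[symmetric] c_def[symmetric]
      by (simp add: algebra_simps power2_eq_square)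
    also have "cmod \<dots> = cmod x * cmod ((1 - x) * (x - 2 * c) - 1)"
      by (rule norm_mult)
    also have "cmod ((1 - x) * (x - 2 * c) - 1) \<le> cmod (1 - x) * cmod (x - 2 * c) + 1"
      by (metis norm_triangle_ineq4 norm_mult norm_one)
    also have "cmod (1 - x) * cmod (x - 2 * c) \<le> 2 * (2 * C + 1)"
    proof (rule mult_mono)
      show "cmod (1 - x) \<le> 2"
        using norm_triangle_ineq4[of 1 x] x1 by simp
      show "cmod (x - 2 * c) \<le> 2 * C + 1"
        using norm_triangle_ineq4[of x "2 * c"] x1 c by (simp add: norm_mult)
    qed auto
    finally have "cmod (a n z - 1) \<le> cmod x * M"
      by (simp add: M_def mult_left_mono)
    also have "\<dots> \<le> cmod q ^ n * M"
      using xq C0 by (intro mult_right_mono) (auto simp: M_def)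
    finally show ?thesis by (simp add: mult.commute)
  qed
  have "summable (\<lambda>n. M * cmod q ^ n)"
    using q by (intro summable_mult summable_geometric) auto
  then have "uniformly_convergent_on K (\<lambda>N z. \<Sum>n<N. norm (a n z - 1))"
    by (intro Weierstrass_m_test'[OF bound])
  from uniformly_convergent_on_prod'[OF cont K this]
  have uc: "uniformly_convergent_on K (\<lambda>N z. \<Prod>n<N. a n z)" .
  have conv: "convergent_prod (\<lambda>n. a n z)" if "z \<in> K" for z
  proof -
    have "summable (\<lambda>n. norm (a n z - 1))"
      by (rule summable_comparison_test'[OF \<open>summable (\<lambda>n. M * cmod q ^ n)\<close>]) (use bound that in auto)
    then show ?thesis
      by (intro abs_convergent_prod_imp_convergent_prod summable_imp_abs_convergent_prod)
  qed
  obtain l where l: "uniform_limit K (\<lambda>N z. \<Prod>n<N. a n z) l sequentially"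
    using uc by (auto simp: uniformly_convergent_on_def)
  have "l z = (\<Prod>n. a n z)" if "z \<in> K" for z
  proof (rule LIMSEQ_unique)
    show "(\<lambda>N. \<Prod>n<N. a n z) \<longlonglongrightarrow> l z"
      using tendsto_uniform_limitI[OF l that] .
    show "(\<lambda>N. \<Prod>n<N. a n z) \<longlonglongrightarrow> (\<Prod>n. a n z)"
      using convergent_prod_LIMSEQ[OF conv[OF that]]
      by (simp add: LIMSEQ_lessThan_iff_atMost[of "prod (\<lambda>n. a n z)"])
  qed
  then have "uniform_limit K (\<lambda>N z. \<Prod>n<N. a n z) (\<lambda>z. \<Prod>n. a n z) sequentially"
    using l by (simp cong: uniform_limit_cong')
  then have "continuous_on K (\<lambda>z. \<Prod>n. a n z)"
    by (rule uniform_limit_theorem[rotated])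
      (auto intro!: always_eventually continuous_intros cont)
  then show ?thesis
    unfolding a_def theta_product_def .
qed

text \<open>
  At 0 the factors become \<open>(1 - q\<^bsup>2n\<^esup>)\<^sup>3\<close>, none of which vanishes for \<open>\<bar>q\<bar> < 1\<close>.
\<close>

lemma theta_product_0_nonzero:
  assumes q: "cmod q < 1"
  shows "theta_product q 0 \<noteq> 0"
proof -
  have eq: "(1 - q ^ (2 * Suc n)) * (1 - 2 * cos (2 * of_real pi * 0) * q ^ (2 * Suc n) + q ^ (4 * Suc n))
     = (1 - q ^ (2 * Suc n)) ^ 3" for n
  proof -
    define x where "x = q ^ (2 * Suc n)"
    have x4: "q ^ (4 * Suc n) = x\<^sup>2"
      unfolding x_def power_mult[symmetric] by (rule arg_cong[where f = "power q"]) simp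
    show ?thesis
      unfolding x4 x_def[symmetric] by (simp add: power2_eq_square power3_eq_cube algebra_simps)
  qed
  have "summable (\<lambda>n. norm ((1 - q ^ (2 * Suc n)) - 1))"
    by (rule summable_comparison_test'[of "\<lambda>n. cmod q ^ n" 0])
      (use q in \<open>auto intro!: summable_geometric power_decreasing simp: norm_power simp del: power_Suc\<close>)
  then have cv: "convergent_prod (\<lambda>n. 1 - q ^ (2 * Suc n))"
    by (intro abs_convergent_prod_imp_convergent_prod summable_imp_abs_convergent_prod)
  have nz: "1 - q ^ (2 * Suc n) \<noteq> 0" for n
  proof
    assume "1 - q ^ (2 * Suc n) = 0"
    then have "q ^ (2 * Suc n) = 1"
      by simp
    then have "cmod q ^ (2 * Suc n) = 1"
      using norm_power[of q "2 * Suc n"] by (simp only: norm_one)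
    moreover have "cmod q ^ (2 * Suc n) < 1"
      using q by (intro power_Suc_less_one power_less_one_iff[THEN iffD2]) auto
    ultimately show False
      by (simp only:)
  qed
  have "convergent_prod (\<lambda>n. (1 - q ^ (2 * Suc n)) ^ 3)"
    using cv by (simp only: power3_eq_cube) (intro convergent_prod_mult)
  then show ?thesis
    unfolding theta_product_def eq using nz by (intro prodinf_nonzero) auto
qed

lemma norm_nome_less_1: "Im \<tau> > 0 \<Longrightarrow> cmod (exp (of_real pi * \<i> * \<tau>)) < 1"
  by simp

lemma theta1_linear_factor:
  assumes "Im \<tau> > 0"
  obtains g where "continuous_on (cball 0 1) g" "g 0 \<noteq> 0" "\<And>z. theta1 \<tau> z = z * g z"
proof
  define q where "q = exp (of_real pi * \<i> * \<tau>)"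
  \<comment> \<open>The sine divided by its zero, continued by its derivative \<open>\<pi>\<close> at 0.\<close>
  define s where "s = (\<lambda>z::complex. if z = 0 then of_real pi else sin (of_real pi * z) / z)"
  define g where "g = (\<lambda>z. 2 * exp (of_real pi * \<i> * \<tau> / 4) * s z * theta_product q z)"
  have q: "cmod q < 1"
    unfolding q_def using assms by (rule norm_nome_less_1)
  have "isCont s z" for z
  proof (cases "z = 0")
    case True
    have "((\<lambda>z::complex. sin (of_real pi * z)) has_field_derivative of_real pi) (at 0)"
      by (auto intro!: derivative_eq_intros)
    then have "(\<lambda>z::complex. sin (of_real pi * z) / z) \<midarrow>0\<rightarrow> of_real pi"
      by (simp add: has_field_derivative_iff)
    then have "s \<midarrow>0\<rightarrow> of_real pi"
      by (rule Lim_transform_eventually) (auto simp: s_def eventually_at_filter)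
    then show ?thesis
      using True by (simp add: isCont_def s_def)
  next
    case False
    have "isCont (\<lambda>z::complex. sin (of_real pi * z) / z) z"
      using False by (intro continuous_intros)
    moreover have "eventually (\<lambda>x. sin (of_real pi * x) / x = s x) (nhds z)"
      using t1_space_nhds[OF False] by eventually_elim (auto simp: s_def)
    ultimately show ?thesis
      using isCont_cong by fast
  qed
  then have "continuous_on (cball 0 1) s"
    by (simp add: continuous_at_imp_continuous_on)
  then show "continuous_on (cball 0 1) g"
    unfolding g_def
    by (intro continuous_on_mult continuous_on_const continuous_on_theta_product[OF q] compact_cball)
  show "g 0 \<noteq> 0"
    using theta_product_0_nonzero[OF q] by (simp add: g_def s_def)
  show "theta1 \<tau> z = z * g z" for z
    by (simp add: theta1_def Let_def g_def s_def theta_product_def q_def)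
qed

text \<open>
  The linear factor of \<open>\<theta>\<^sub>1(z - w)\<close> cancels the logarithmic term, and what remains is continuous
  at \<open>z = w\<close>.
\<close>

lemma fundamental_density_eq:
  assumes g: "continuous_on (cball 0 1) g" "g 0 \<noteq> 0" "\<And>z. theta1 \<tau> z = z * g z"
    and w: "w \<noteq> u" "cmod (w - u) < 1" "g (w - u) \<noteq> 0"
  shows "fundamental_density \<tau> u w = cmod (g 0) / (cmod (w - u) * cmod (g (w - u)))"
proof -
  have cont: "isCont g x" if "cmod x < 1" for x
    using continuous_on_interior[OF g(1)] that by simp
  define h where "h = (\<lambda>z. cmod (g (z - w)) / cmod ((z - u) * g (z - u)))"
  have shift: "isCont (\<lambda>z. g (z - v)) w" if "cmod (w - v) < 1" for v
    by (rule isCont_o2[where g = g]) (use cont[OF that] in auto)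
  have "isCont h w"
    unfolding h_def using w by (intro isCont_divide isCont_norm isCont_mult shift) auto
  then have lim: "(h \<longlongrightarrow> h w) (at w)"
    by (simp add: isCont_def)
  have hw: "h w > 0"
    using w g(2) by (simp add: h_def)
  have "((\<lambda>z. ln (h z)) \<longlongrightarrow> ln (h w)) (at w)"
    using lim hw by (intro tendsto_ln) auto
  moreover have "eventually (\<lambda>z. ln (h z) = evans_selberg_potential \<tau> u w z - ln (cmod (z - w))) (at w)"
  proof -
    have "eventually (\<lambda>z. h z > 0) (at w)"
      using order_tendstoD(1)[OF lim hw] .
    moreover have "eventually (\<lambda>z. z \<noteq> w) (at w)"
      by (simp add: eventually_at_filter)
    ultimately show ?thesis
    proof eventually_elim
      case (elim z)
      have "cmod (theta1 \<tau> (z - w) / theta1 \<tau> (z - u)) = cmod (z - w) * h z"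
        by (simp add: g(3) h_def norm_mult norm_divide)
      then show ?case
        using elim by (simp add: evans_selberg_potential_def ln_mult)
    qed
  qed
  ultimately have "((\<lambda>z. evans_selberg_potential \<tau> u w z - ln (cmod (z - w))) \<longlongrightarrow> ln (h w)) (at w)"
    by (rule Lim_transform_eventually)
  then have "fundamental_density \<tau> u w = exp (ln (h w))"
    unfolding fundamental_density_def by (simp add: tendsto_Lim)
  then show ?thesis
    using hw by (simp add: h_def norm_mult)
qed

section \<open>Behaviour at the puncture\<close>

theorem theorem1p1:
  fixes \<tau> u :: complex
  assumes "Im \<tau> > 0"
  shows "(\<lambda>w. pi * bergman_density \<tau> u w / (fundamental_density \<tau> u w)\<^sup>2)
           \<sim>[at u] (\<lambda>w. pi * (cmod (w - u))\<^sup>2 / (2 * Im \<tau>))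
       \<and> filterlim (\<lambda>w. pi * (cmod (w - u))\<^sup>2 / (2 * Im \<tau>)) (at_right 0) (at u)
       \<and> filterlim (\<lambda>w. pi * bergman_density \<tau> u w / (fundamental_density \<tau> u w)\<^sup>2)
           (at_right 0) (at u)"
proof -
  define L where "L = (\<lambda>w. pi * bergman_density \<tau> u w / (fundamental_density \<tau> u w)\<^sup>2)"
  define R where "R = (\<lambda>w. pi * (cmod (w - u))\<^sup>2 / (2 * Im \<tau>))"
  obtain g where g: "continuous_on (cball 0 1) g" "g 0 \<noteq> 0" "\<And>z. theta1 \<tau> z = z * g z"
    using theta1_linear_factor[OF assms] by blast
  \<comment> \<open>The quotient of the two sides of the asymptotic equivalence.\<close>
  define \<rho> where "\<rho> = (\<lambda>w. (cmod (g (w - u)) / cmod (g 0))\<^sup>2)"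
  have "isCont g 0"
    using continuous_on_interior[OF g(1)] by simp
  then have gl: "((\<lambda>w. g (w - u)) \<longlongrightarrow> g 0) (at u)"
    by (intro isCont_tendsto_compose[of 0 g] tendsto_eq_intros) auto
  then have "(\<rho> \<longlongrightarrow> (cmod (g 0) / cmod (g 0))\<^sup>2) (at u)"
    unfolding \<rho>_def using g(2) by (intro tendsto_intros) auto
  then have \<rho>: "(\<rho> \<longlongrightarrow> 1) (at u)"
    using g(2) by simp
  have "eventually (\<lambda>w. g (w - u) \<noteq> 0) (at u)"
    using tendsto_imp_eventually_ne[OF gl g(2)] .
  moreover have "eventually (\<lambda>w. w \<in> ball u (min 1 (Im \<tau>)) - {u}) (at u)"
    using assms eventually_at_ball'[of "min 1 (Im \<tau>)" u UNIV] by (auto elim!: eventually_mono)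
  ultimately have ev: "eventually (\<lambda>w. w \<noteq> u \<and> \<rho> w > 0 \<and> L w = R w * \<rho> w) (at u)"
  proof eventually_elim
    case (elim w)
    have "u \<in> puncture_reps \<tau> u"
      by (simp add: puncture_reps_iff)
    then have "w \<notin> puncture_reps \<tau> u"
      using puncture_reps_isolated[OF assms, of u u w] elim by (auto simp: dist_commute)
    then have "bergman_density \<tau> u w = 1 / (2 * Im \<tau>)"
      by (rule bergman_density_eq[OF assms])
    moreover have "fundamental_density \<tau> u w = cmod (g 0) / (cmod (w - u) * cmod (g (w - u)))"
      by (rule fundamental_density_eq[OF g]) (use elim in \<open>auto simp: dist_norm norm_minus_commute\<close>)
    ultimately show ?case
      using elim g(2) by (simp add: L_def R_def \<rho>_def power_divide power_mult_distrib mult_ac)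
  qed
  have "L \<sim>[at u] R"
  proof (rule asymp_equivI')
    have "eventually (\<lambda>w. \<rho> w = L w / R w) (at u)"
      using ev by eventually_elim (use assms in \<open>auto simp: R_def\<close>)
    then show "((\<lambda>w. L w / R w) \<longlongrightarrow> 1) (at u)"
      using \<rho> by (rule Lim_transform_eventually[rotated])
  qed
  moreover have R0: "(R \<longlongrightarrow> 0) (at u)"
  proof -
    have "isCont R u"
      unfolding R_def using assms by (intro continuous_intros) auto
    then show ?thesis
      by (simp add: isCont_def R_def)
  qed
  moreover have Rpos: "eventually (\<lambda>w. R w > 0) (at u)"
    using ev by eventually_elim (use assms in \<open>auto simp: R_def\<close>)
  moreover have "((\<lambda>w. R w * \<rho> w) \<longlongrightarrow> 0) (at u)"
    using tendsto_mult[OF R0 \<rho>] by simp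
  then have "(L \<longlongrightarrow> 0) (at u)"
    by (rule Lim_transform_eventually) (use ev in \<open>auto elim!: eventually_mono\<close>)
  moreover have "eventually (\<lambda>w. L w > 0) (at u)"
    using ev Rpos by eventually_elim simp
  ultimately show ?thesis
    unfolding L_def R_def by (intro conjI filterlim_at_withinI) auto
qed

end
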